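(* Let $D\subseteq\mathbb{C}$ be a domain, let $\mathcal{F}$ be a family of holomorphic functions on $D$, and let $a,b$ be two distinct complex numbers. Suppose there exist a holomorphic function $h$ on $D$ and a constant $\rho>0$ such that for each $f\in\mathcal{F}$ there is a value $c_f\in D^*_\rho(0)$ (depending on $f$) for which $f$ and $f'$ partially share the two pairs $(a,h)$ and $(b,c_f)$ on $D$; that is, for every $z\in D$: $f(z)=a$ implies $f'(z)=h(z)$, and $f(z)=b$ implies $f'(z)=c_f$. Then $\mathcal{F}$ is normal in $D$.
   Context: $D^*_\rho(0)=\{z\in\mathbb{C}:0<|z|<\rho\}$ is the punctured disk. Two meromorphic functions $f,g$ on $D$ partially share a pair $(\alpha,\beta)$, where $\alpha\in\mathbb{C}$ and $\beta$ is a complex number or a holomorphic function on $D$, if for every $z\in D$, $f(z)=\alpha$ implies $g(z)=\beta$ (respectively $g(z)=\beta(z)$). A family $\mathcal{F}$ of meromorphic (in particular, holomorphic) functions on $D$ is normal in $D$ if every sequence in $\mathcal{F}$ has a subsequence converging locally uniformly in $D$ with respect to the spherical metric; the limit is a meromorphic function on $D$ or identically $\infty$. *)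

theory Defs
  imports "HOL-Complex_Analysis.Complex_Analysis"
begin

text \<open>
  The Riemann sphere is \<open>complex option\<close>, with \<open>None\<close> as the point at infinity. The spherical
  metric is the great-circle distance on the unit sphere of \<open>complex \<times> real\<close>, transported by
  the stereographic projection from the north pole \<open>(0, 1)\<close>.
\<close>

type_synonym riemann_sphere = "complex option"

definition sphere_point :: "riemann_sphere \<Rightarrow> complex \<times> real" where
  "sphere_point p = (case p of
      None \<Rightarrow> (0, 1)
    | Some z \<Rightarrow> (2 *\<^sub>R z /\<^sub>R (1 + (cmod z)\<^sup>2), ((cmod z)\<^sup>2 - 1) / ((cmod z)\<^sup>2 + 1)))"

definition spherical_dist :: "riemann_sphere \<Rightarrow> riemann_sphere \<Rightarrow> real" where
  "spherical_dist p q = arccos (sphere_point p \<bullet> sphere_point q)"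

text \<open>
  The library represents a meromorphic function as a total function \<open>complex \<Rightarrow> complex\<close>, which for
  \<open>nicely_meromorphic_on\<close> is continuous off its poles and has the dummy value 0 at them.
  The following recovers the associated map to the sphere.
\<close>

definition sphere_val :: "(complex \<Rightarrow> complex) \<Rightarrow> complex \<Rightarrow> riemann_sphere" where
  "sphere_val f z = (if is_pole f z then None else Some (f z))"

definition locally_uniform_limit_spherical ::
    "complex set \<Rightarrow> (nat \<Rightarrow> complex \<Rightarrow> riemann_sphere) \<Rightarrow> (complex \<Rightarrow> riemann_sphere) \<Rightarrow> bool" where
  "locally_uniform_limit_spherical D f g \<longleftrightarrow>
     (\<forall>z\<in>D. \<exists>r>0. ball z r \<subseteq> D \<and>
        uniform_limit (ball z r) (\<lambda>n w. spherical_dist (f n w) (g w)) (\<lambda>_. 0) sequentially)"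

definition normal_family :: "complex set \<Rightarrow> (complex \<Rightarrow> complex) set \<Rightarrow> bool" where
  "normal_family D F \<longleftrightarrow>
     (\<forall>f :: nat \<Rightarrow> complex \<Rightarrow> complex. range f \<subseteq> F \<longrightarrow>
        (\<exists>r g. strict_mono r \<and>
           locally_uniform_limit_spherical D (\<lambda>n. sphere_val (f (r n))) g \<and>
           ((\<exists>m. m nicely_meromorphic_on D \<and> (\<forall>z\<in>D. g z = sphere_val m z)) \<or>
            (\<forall>z\<in>D. g z = None))))"

text \<open>
  The shared value \<open>\<beta>\<close> is a function throughout; a shared constant \<open>c\<close> is \<open>\<lambda>_. c\<close>. Values are
  compared on the sphere so that the dummy value at a pole does not count as a value.
\<close>

definition partially_share ::
    "complex set \<Rightarrow> (complex \<Rightarrow> complex) \<Rightarrow> (complex \<Rightarrow> complex) \<Rightarrow> complex \<Rightarrow> (complex \<Rightarrow> complex) \<Rightarrow> bool"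
  where
  "partially_share D f g \<alpha> \<beta> \<longleftrightarrow>
     (\<forall>z\<in>D. sphere_val f z = Some \<alpha> \<longrightarrow> sphere_val g z = Some (\<beta> z))"

definition punctured_disk :: "real \<Rightarrow> complex set" where
  "punctured_disk \<rho> = {z. 0 < cmod z \<and> cmod z < \<rho>}"

end

theory Submission
  imports Defs "HOL-Library.Diagonal_Subsequence" "HOL-Real_Asymp.Real_Asymp"
begin

text \<open>
  The argument is a rescaling argument by contradiction. Normality follows once the spherical
  derivative \<open>\<bar>f'\<bar> / (1 + \<bar>f\<bar>\<^sup>2)\<close> is locally bounded along the family
  (\<open>Marty_subsequence\<close>, a form of Marty's criterion). If it is unbounded near some point, then
  Zalcman's rescaling (\<open>Zalcman\<close>) produces functions \<open>\<phi>\<^sub>n \<zeta> = f\<^sub>n (w\<^sub>n + \<rho>\<^sub>n \<zeta>)\<close> with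
  \<open>\<rho>\<^sub>n \<rightarrow> 0\<close> that converge locally uniformly on the plane to an entire function \<open>g\<close> whose
  spherical derivative is bounded everywhere and equal to 1 at the origin. Differentiation brings
  out a factor \<open>\<rho>\<^sub>n\<close>, so the two shared pairs say that at \<open>a\<close>-points and at \<open>b\<close>-points the
  derivative of \<open>\<phi>\<^sub>n\<close> tends to 0. This has different consequences for the two values.

  At the \<open>a\<close>-points only the smallness survives: every \<open>a\<close>-point of \<open>g\<close> is multiple, by
  Hurwitz's theorem (\<open>limit_ramified_value\<close>). At the \<open>b\<close>-points the derivative of \<open>\<phi>\<^sub>n\<close> is a
  constant \<open>\<epsilon>\<^sub>n = \<rho>\<^sub>n c\<^sub>n\<close> that is not 0, and this is much stronger: the zeros of \<open>\<phi>\<^sub>n - b\<close> are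
  simple and are zeros of \<open>\<phi>\<^sub>n' - \<epsilon>\<^sub>n\<close>, so \<open>(\<phi>\<^sub>n' - \<epsilon>\<^sub>n) / (\<phi>\<^sub>n - b)\<close> has no poles. The maximum
  principle bounds this quotient uniformly, whereas its limit \<open>g' / (g - b)\<close> has a pole at
  each \<open>b\<close>-point of \<open>g\<close>. Hence \<open>g\<close> omits \<open>b\<close> (\<open>limit_omits_value\<close>).

  It remains to exclude such a \<open>g\<close> (\<open>entire_simple_point\<close>). Write \<open>g = b + exp p\<close> with \<open>p\<close> entire.
  The bound on the spherical derivative of \<open>g\<close> bounds \<open>p'\<close> on the set \<open>Re p = 0\<close>. Harmonic
  function theory carries this bound to the whole plane: at a point \<open>z\<close> with \<open>Re p z > 0\<close>, whose
  distance from the set \<open>Re p = 0\<close> is \<open>R\<close>, the Schwarz lemma gives \<open>\<bar>p' z\<bar> \<le> 2 Re (p z) / R\<close>,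
  and a quantitative Hopf boundary lemma bounds \<open>Re (p z) / R\<close> by twice the value of \<open>\<bar>p'\<bar>\<close>
  at the nearest boundary point. By Liouville's theorem \<open>p\<close> is linear, and then all
  \<open>a\<close>-points of \<open>g\<close> are simple and there is at least one, a contradiction.
\<close>

section \<open>Entire functions with bounded derivative where the real part vanishes\<close>

lemma norm_plus_cnj_power2:
  fixes u v :: complex
  shows "(norm (u + cnj v))\<^sup>2 = (norm (u - v))\<^sup>2 + 4 * Re u * Re v"
  unfolding cmod_power2 by (simp add: power2_eq_square algebra_simps)

text \<open>
  The Moebius map \<open>v \<mapsto> (v - p z) / (v + cnj (p z))\<close> takes the right half plane to the unit disc and
  \<open>p z\<close> to 0, so both estimates are the Schwarz lemma for its composition with \<open>p\<close>.
\<close>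

lemma Schwarz_right_half_plane:
  assumes holp: "p holomorphic_on ball z R" and R: "0 < R"
    and pos: "\<And>w. w \<in> ball z R \<Longrightarrow> 0 < Re (p w)"
  shows "w \<in> ball z R \<Longrightarrow> R * norm (p w - p z) \<le> norm (w - z) * norm (p w + cnj (p z))"
    and "R * norm (deriv p z) \<le> 2 * Re (p z)"
proof -
  define q where "q x = p (z + of_real R * x)" for x
  define \<phi> where "\<phi> x = (q x - p z) / (q x + cnj (p z))" for x
  have inball: "z + of_real R * x \<in> ball z R" if "norm x < 1" for x
    using that R by (simp add: dist_norm norm_mult)
  have pz: "0 < Re (p z)"
    using pos[of z] R by simp
  have Req: "0 < Re (q x)" if "norm x < 1" for x
    unfolding q_def by (rule pos[OF inball[OF that]])
  have den: "q x + cnj (p z) \<noteq> 0" if "norm x < 1" for x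
    using Req[OF that] pz by (auto simp: complex_eq_iff)
  have holq: "q holomorphic_on ball 0 1"
  proof -
    have "p \<circ> (\<lambda>x. z + of_real R * x) holomorphic_on ball 0 1"
      using inball
      by (intro holomorphic_on_compose_gen[OF _ holp] holomorphic_intros) auto
    then show ?thesis by (simp add: o_def q_def[abs_def])
  qed
  have hol\<phi>: "\<phi> holomorphic_on ball 0 1"
    unfolding \<phi>_def using den by (intro holomorphic_intros holq) auto
  have \<phi>0: "\<phi> 0 = 0" by (simp add: \<phi>_def q_def)
  have \<phi>1: "norm (\<phi> x) < 1" if "norm x < 1" for x
  proof -
    have "(norm (q x - p z))\<^sup>2 < (norm (q x + cnj (p z)))\<^sup>2"
      using norm_plus_cnj_power2[of "q x" "p z"] Req[OF that] pz by simp
    then have "norm (q x - p z) < norm (q x + cnj (p z))"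
      by (rule power2_less_imp_less) simp
    then show ?thesis
      unfolding \<phi>_def norm_divide by (simp add: divide_less_eq)
  qed
  show "R * norm (p w - p z) \<le> norm (w - z) * norm (p w + cnj (p z))" if w: "w \<in> ball z R"
  proof -
    define x where "x = (w - z) / of_real R"
    have x: "norm x < 1"
      using w R by (simp add: x_def norm_divide dist_norm norm_minus_commute)
    have qx: "q x = p w"
      using R by (simp add: q_def x_def)
    have "norm (\<phi> x) \<le> norm x"
      using Schwarz_Lemma(1)[OF hol\<phi> \<phi>0 \<phi>1 x] by simp
    then have "norm (p w - p z) / norm (p w + cnj (p z)) \<le> norm (w - z) / R"
      unfolding \<phi>_def qx using R by (simp add: norm_divide x_def)
    moreover have "0 < norm (p w + cnj (p z))"
      using den[OF x] by (simp add: qx)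
    ultimately show ?thesis
      using R by (simp add: field_simps)
  qed
  have "norm (deriv \<phi> 0) \<le> 1"
    using Schwarz_Lemma(2)[OF hol\<phi> \<phi>0 \<phi>1, of 0] by simp
  moreover have "(\<phi> has_field_derivative (of_real R * deriv p z) / (2 * of_real (Re (p z)))) (at 0)"
  proof -
    have "(p has_field_derivative deriv p z) (at (z + of_real R * 0))"
      using holomorphic_derivI[OF holp, of z] R by simp
    then have "(q has_field_derivative deriv p z * of_real R) (at 0)"
      unfolding q_def
      by (intro DERIV_chain'[where f="\<lambda>x. z + of_real R * x" and g=p, THEN DERIV_cong])
         (auto intro!: derivative_eq_intros)
    then have "(\<phi> has_field_derivative
        ((deriv p z * of_real R) * (q 0 + cnj (p z)) - (q 0 - p z) * (deriv p z * of_real R))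
          / ((q 0 + cnj (p z)) * (q 0 + cnj (p z)))) (at 0)"
      unfolding \<phi>_def using den[of 0]
      by (auto intro!: derivative_eq_intros)
    moreover have "q 0 = p z" by (simp add: q_def)
    moreover have "p z + cnj (p z) = 2 * of_real (Re (p z))"
      by (simp add: complex_add_cnj)
    ultimately show ?thesis
      using pz by (simp add: field_simps)
  qed
  ultimately have "norm ((of_real R * deriv p z) / (2 * of_real (Re (p z)))) \<le> 1"
    by (simp add: DERIV_imp_deriv)
  then show "R * norm (deriv p z) \<le> 2 * Re (p z)"
    using pz R by (simp add: norm_divide norm_mult)
qed

text \<open>
  A positive harmonic function decreases at least linearly towards a boundary zero. On the
  radius from \<open>z\<close> to \<open>w\<close> the preceding Schwarz estimate bounds \<open>Re p\<close> from below by a multiple of the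
  distance to \<open>w\<close>; dividing by this distance gives a lower bound for the derivative at \<open>w\<close>.
\<close>

lemma Hopf_boundary_derivative:
  assumes holp: "p holomorphic_on S" and S: "open S" "cball z R \<subseteq> S" and R: "0 < R"
    and pos: "\<And>w. w \<in> ball z R \<Longrightarrow> 0 < Re (p w)"
    and w: "dist z w = R" "Re (p w) = 0"
  shows "Re (p z) \<le> 2 * R * norm (deriv p w)"
proof -
  have wS: "w \<in> S" using S w by auto
  have pz: "0 < Re (p z)" using pos R by simp
  have holb: "p holomorphic_on ball z R"
    using holp S by (meson ball_subset_cball holomorphic_on_subset order_trans)
  \<comment> \<open>the radius, parametrised from the boundary point inwards\<close>
  define x where "x t = w + of_real t * (z - w)" for t :: real
  have low: "(2 - t) / 4 * Re (p z) \<le> norm ((p (x t) - p w) / of_real t)"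
    if t: "0 < t" "t < 1" for t
  proof -
    have eq: "x t - z = of_real (1 - t) * (w - z)"
      by (simp add: x_def algebra_simps)
    have nx: "norm (x t - z) = (1 - t) * R"
      unfolding eq norm_mult norm_of_real using t w by (simp add: dist_norm norm_minus_commute)
    have xb: "x t \<in> ball z R"
      using nx mult_pos_pos[OF t(1) R] by (simp add: dist_norm norm_minus_commute algebra_simps)
    have "R * norm (p (x t) - p z) \<le> (1 - t) * R * norm (p (x t) + cnj (p z))"
      using Schwarz_right_half_plane(1)[OF holb R pos xb] nx by simp
    then have "norm (p (x t) - p z) \<le> (1 - t) * norm (p (x t) + cnj (p z))"
      using R by (simp add: mult.commute mult.left_commute)
    then have "(norm (p (x t) - p z))\<^sup>2 \<le> ((1 - t) * norm (p (x t) + cnj (p z)))\<^sup>2"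
      by (rule power_mono) simp
    then have "(norm (p (x t) - p z))\<^sup>2 \<le> (1 - t)\<^sup>2 * (norm (p (x t) + cnj (p z)))\<^sup>2"
      by (simp only: power_mult_distrib)
    then have "(1 - (1 - t)\<^sup>2) * (norm (p (x t) + cnj (p z)))\<^sup>2 \<le> 4 * Re (p (x t)) * Re (p z)"
      unfolding left_diff_distrib[of 1 "(1 - t)\<^sup>2"]
      using norm_plus_cnj_power2[of "p (x t)" "p z"] by linarith
    moreover have "(Re (p z))\<^sup>2 \<le> (norm (p (x t) + cnj (p z)))\<^sup>2"
    proof (rule power_mono)
      show "Re (p z) \<le> norm (p (x t) + cnj (p z))"
        using complex_Re_le_cmod[of "p (x t) + cnj (p z)"] pos[OF xb] by simp
    qed (use pz in simp)
    moreover have "0 \<le> 1 - (1 - t)\<^sup>2"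
      using t by (simp add: power2_eq_square algebra_simps mult_le_one)
    ultimately have "(1 - (1 - t)\<^sup>2) * (Re (p z))\<^sup>2 \<le> 4 * Re (p (x t)) * Re (p z)"
      by (meson mult_left_mono order_trans)
    then have "((1 - (1 - t)\<^sup>2) * Re (p z)) * Re (p z) \<le> (4 * Re (p (x t))) * Re (p z)"
      by (simp add: power2_eq_square algebra_simps)
    then have "(1 - (1 - t)\<^sup>2) * Re (p z) \<le> 4 * Re (p (x t))"
      by (rule mult_right_le_imp_le[OF _ pz])
    also have "Re (p (x t)) \<le> norm (p (x t) - p w)"
      using complex_Re_le_cmod[of "p (x t) - p w"] w by simp
    finally have "t * ((2 - t) * Re (p z)) \<le> 4 * norm (p (x t) - p w)"
      by (simp add: power2_eq_square algebra_simps)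
    then show ?thesis
      using t by (simp add: norm_divide field_simps)
  qed
  define h where "h t = of_real t * (z - w)" for t :: real
  have "((\<lambda>x. (p (w + x) - p w) / x) \<longlongrightarrow> deriv p w) (at 0)"
    using DERIV_D[OF holomorphic_derivI[OF holp S(1) wS]] .
  moreover have "filterlim h (at 0) (at_right 0)"
    unfolding filterlim_at
  proof
    show "\<forall>\<^sub>F t in at_right 0. h t \<in> UNIV \<and> h t \<noteq> 0"
      using w R by (auto simp: h_def eventually_at_filter)
    have "(h \<longlongrightarrow> of_real 0 * (z - w)) (at_right 0)"
      unfolding h_def by (intro tendsto_intros)
    then show "(h \<longlongrightarrow> 0) (at_right 0)" by simp
  qed
  ultimately have "((\<lambda>t. (p (w + h t) - p w) / h t) \<longlongrightarrow> deriv p w) (at_right 0)"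
    by (rule filterlim_compose)
  then have lim1: "((\<lambda>t. R * norm ((p (w + h t) - p w) / h t)) \<longlongrightarrow> R * norm (deriv p w)) (at_right 0)"
    by (intro tendsto_intros)
  have lim2: "((\<lambda>t. (2 - t) / 4 * Re (p z)) \<longlongrightarrow> (2 - 0) / 4 * Re (p z)) (at_right (0::real))"
    by (intro tendsto_intros) simp
  have "\<forall>\<^sub>F t in at_right 0. t < 1 \<and> 0 < (t::real)"
    unfolding eventually_at_right[OF zero_less_one] by (intro exI[of _ 1]) auto
  then have "\<forall>\<^sub>F t in at_right 0. (2 - t) / 4 * Re (p z) \<le> R * norm ((p (w + h t) - p w) / h t)"
  proof eventually_elim
    case (elim t)
    have "norm (z - w) = R" using w by (simp add: dist_norm)
    then show ?case
      using low[of t] elim R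
      by (simp add: x_def h_def norm_divide norm_mult)
  qed
  then have "(2 - 0) / 4 * Re (p z) \<le> R * norm (deriv p w)"
    by (rule tendsto_le[OF trivial_limit_at_right_real lim1 lim2])
  then show ?thesis by simp
qed

text \<open>
  The largest disc around \<open>z\<close> in which \<open>Re p\<close> stays positive touches the set \<open>Re p = 0\<close>. Its
  radius cancels between the Schwarz estimate at the centre and the Hopf estimate at the point of
  contact, so the bound does not depend on \<open>z\<close>.
\<close>

lemma deriv_bound_from_real_part:
  assumes holp: "p holomorphic_on UNIV"
    and C: "\<And>w. Re (p w) = 0 \<Longrightarrow> norm (deriv p w) \<le> C"
    and w0: "Re (p w0) = 0" and z: "0 < Re (p z)"
  shows "norm (deriv p z) \<le> 4 * C"
proof -
  let ?Z = "{w. Re (p w) = 0}"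
  have contp: "continuous_on UNIV p"
    by (rule holomorphic_on_imp_continuous_on[OF holp])
  have "closed ?Z"
    by (intro closed_Collect_eq continuous_intros contp)
  then obtain w where w: "Re (p w) = 0" and near: "\<And>v. Re (p v) = 0 \<Longrightarrow> dist z w \<le> dist z v"
    using distance_attains_inf[of ?Z z] w0 by auto
  define R where "R = dist z w"
  have R: "0 < R" using w z by (auto simp: R_def)
  have pos: "0 < Re (p v)" if v: "v \<in> ball z R" for v
  proof (rule ccontr)
    assume neg: "\<not> 0 < Re (p v)"
    have "connected ((\<lambda>x. Re (p x)) ` ball z R)"
      by (intro connected_continuous_image continuous_intros continuous_on_subset[OF contp]) auto
    moreover have "Re (p v) \<in> (\<lambda>x. Re (p x)) ` ball z R" "Re (p z) \<in> (\<lambda>x. Re (p x)) ` ball z R"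
      using v R by auto
    ultimately have "0 \<in> (\<lambda>x. Re (p x)) ` ball z R"
      using neg z unfolding connected_iff_interval by (meson less_imp_le not_less)
    then obtain x where "x \<in> ball z R" "Re (p x) = 0" by auto
    then show False using near[of x] by (simp add: R_def)
  qed
  have "R * norm (deriv p z) \<le> 2 * Re (p z)"
    using Schwarz_right_half_plane(2)[of p z R] holp R pos holomorphic_on_subset by blast
  also have "\<dots> \<le> 2 * (2 * R * norm (deriv p w))"
    using Hopf_boundary_derivative[OF holp open_UNIV subset_UNIV R pos R_def[symmetric] w] by simp
  also have "\<dots> \<le> 2 * (2 * R * C)"
    using C[OF w] R by simp
  finally have "R * norm (deriv p z) \<le> R * (4 * C)" by simp
  then show ?thesis using R by simp
qed

text \<open>
  The derivative is bounded on the whole plane by \<open>deriv_bound_from_real_part\<close>, applied to \<open>p\<close> and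
  to \<open>- p\<close>, and Liouville's theorem applies. If \<open>Re p\<close> has no zero, then \<open>p\<close> omits a whole line
  and is constant by Picard's little theorem.
\<close>

lemma entire_deriv_constant:
  assumes holp: "p holomorphic_on UNIV"
    and C: "\<And>w. Re (p w) = 0 \<Longrightarrow> norm (deriv p w) \<le> C"
  shows "\<exists>A. \<forall>z. deriv p z = A"
proof (cases "\<exists>w0. Re (p w0) = 0")
  case True
  then obtain w0 where w0: "Re (p w0) = 0" by blast
  have holm: "(\<lambda>z. - p z) holomorphic_on UNIV"
    by (intro holomorphic_intros holp)
  have dm: "deriv (\<lambda>z. - p z) z = - deriv p z" for z
    using holp by (intro deriv_minus) (simp add: holomorphic_on_def)
  have C0: "0 \<le> C" using C[OF w0] norm_ge_zero order_trans by blast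
  have "norm (deriv p z) \<le> 4 * C" for z
  proof (cases "Re (p z)" "0::real" rule: linorder_cases)
    case less
    then show ?thesis
      using deriv_bound_from_real_part[OF holm, of C w0 z] C w0 by (simp add: dm)
  next
    case equal
    then show ?thesis using C[of z] C0 by simp
  next
    case greater
    then show ?thesis
      using deriv_bound_from_real_part[OF holp C w0] by simp
  qed
  then have "bounded (range (deriv p))"
    by (auto simp: bounded_iff)
  moreover have "deriv p holomorphic_on UNIV"
    by (intro holomorphic_deriv holp) simp
  ultimately have "deriv p constant_on UNIV"
    by (rule Liouville_theorem[rotated])
  then show ?thesis by (auto simp: constant_on_def)
next
  case False
  then have "p x \<noteq> 0" "p x \<noteq> \<i>" for x
    by (metis zero_complex.sel(1), metis imaginary_unit.sel(1))
  then have "range p \<inter> {0, \<i>} = {}"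
    by (metis (no_types, lifting) disjoint_iff imageE insertE singletonD)
  then obtain c where "p = (\<lambda>x. c)"
    using little_Picard[OF holp, of 0 \<i>] by auto
  then show ?thesis by auto
qed

section \<open>Values of limits of holomorphic functions\<close>

lemma Cauchy_deriv_bound:
  assumes holf: "f holomorphic_on ball z e" and bd: "\<And>w. w \<in> ball z e \<Longrightarrow> norm (f w) \<le> B" and e: "0 < e"
  shows "norm (deriv f z) \<le> B / e"
proof -
  \<comment> \<open>\<open>f\<close> need not extend to the closed disc, so the radius tends to \<open>e\<close> from below\<close>
  have "r * norm (deriv f z) \<le> B" if r: "r \<in> {0<..<e}" for r
  proof -
    have sub: "cball z r \<subseteq> ball z e" using r by auto
    have "norm ((deriv ^^ 1) f z) \<le> fact 1 * B / r ^ 1"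
    proof (rule Cauchy_inequality)
      show "f holomorphic_on ball z r"
        using holf by (rule holomorphic_on_subset) (use r in auto)
      show "continuous_on (cball z r) f"
        by (rule continuous_on_subset[OF holomorphic_on_imp_continuous_on[OF holf] sub])
      show "norm (f x) \<le> B" if "norm (z - x) = r" for x
        using bd[of x] that r by (simp add: dist_norm)
    qed (use r in auto)
    then show ?thesis using r by (simp add: field_simps)
  qed
  moreover have "((\<lambda>r. r * norm (deriv f z)) \<longlongrightarrow> e * norm (deriv f z)) (at_left e)"
    by (intro tendsto_intros)
  moreover have "\<forall>\<^sub>F r in at_left e. r \<in> {0<..<e}"
    using e by (rule eventually_at_left_field[THEN iffD2, OF exI[of _ 0], OF conjI]) auto
  ultimately have "e * norm (deriv f z) \<le> B"
    by (intro tendsto_upperbound[of "\<lambda>r. r * norm (deriv f z)" _ "at_left e"])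
       (auto elim: eventually_mono)
  then show ?thesis using e by (simp add: field_simps)
qed

lemma uniform_limit_deriv:
  assumes lim: "uniform_limit (ball z e) f g sequentially"
    and hol: "\<forall>\<^sub>F n in sequentially. f n holomorphic_on ball z e"
    and holg: "g holomorphic_on ball z e" and e: "0 < e"
  shows "uniform_limit (ball z (e / 2)) (\<lambda>n. deriv (f n)) (deriv g) sequentially"
proof (rule uniform_limitI)
  fix \<epsilon> :: real assume \<epsilon>: "0 < \<epsilon>"
  have "\<forall>\<^sub>F n in sequentially. \<forall>w\<in>ball z e. dist (f n w) (g w) < \<epsilon> * e / 4"
    by (rule uniform_limitD[OF lim]) (use \<epsilon> e in auto)
  with hol show "\<forall>\<^sub>F n in sequentially. \<forall>w\<in>ball z (e / 2). dist (deriv (f n) w) (deriv g w) < \<epsilon>"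
  proof eventually_elim
    case (elim n)
    show ?case
    proof
      fix w assume w: "w \<in> ball z (e / 2)"
      have sub: "ball w (e / 2) \<subseteq> ball z e"
      proof
        fix x assume "x \<in> ball w (e / 2)"
        then show "x \<in> ball z e" using w dist_triangle[of z x w] by simp
      qed
      have we: "w \<in> ball z e" using w e by auto
      have "norm (deriv (\<lambda>x. f n x - g x) w) \<le> (\<epsilon> * e / 4) / (e / 2)"
      proof (rule Cauchy_deriv_bound)
        show "(\<lambda>x. f n x - g x) holomorphic_on ball w (e / 2)"
          using elim(1) holg sub by (intro holomorphic_intros) (auto intro: holomorphic_on_subset)
        show "norm (f n x - g x) \<le> \<epsilon> * e / 4" if "x \<in> ball w (e / 2)" for x
          using elim(2) that sub by (metis dist_norm less_imp_le subsetD)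
      qed (use e in auto)
      moreover have "deriv (\<lambda>x. f n x - g x) w = deriv (f n) w - deriv g w"
        using elim(1) holg we
        by (intro deriv_diff) (auto intro: holomorphic_on_imp_differentiable_at)
      ultimately show "dist (deriv (f n) w) (deriv g w) < \<epsilon>"
        using e \<epsilon> by (simp add: dist_norm field_simps)
    qed
  qed
qed

text \<open>
  Zeros of \<open>P\<close> cancel simple zeros of \<open>Q\<close>, so \<open>P / Q\<close> has only removable singularities. The value
  filled in at a zero is the one given by l'Hospital's rule; near such a point the quotient equals
  that of the two difference quotients.
\<close>

lemma holomorphic_divisible_by_simple_zeros:
  assumes P: "P holomorphic_on S" and Q: "Q holomorphic_on S" and S: "open S"
    and simple: "\<And>z. z \<in> S \<Longrightarrow> Q z = 0 \<Longrightarrow> P z = 0 \<and> deriv Q z \<noteq> 0"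
  shows "\<exists>q. q holomorphic_on S \<and> (\<forall>z\<in>S. P z = q z * Q z)"
proof -
  define q where "q z = (if Q z = 0 then deriv P z / deriv Q z else P z / Q z)" for z
  have "\<exists>T. open T \<and> z \<in> T \<and> q holomorphic_on T" if z: "z \<in> S" for z
  proof (cases "Q z = 0")
    case False
    have "open (S \<inter> Q -` (- {0}))"
      using holomorphic_on_imp_continuous_on[OF Q] S by (intro continuous_open_preimage) auto
    moreover have "(\<lambda>x. P x / Q x) holomorphic_on S \<inter> Q -` (- {0})"
      using P Q by (intro holomorphic_intros) (auto intro: holomorphic_on_subset)
    then have "q holomorphic_on S \<inter> Q -` (- {0})"
      by (rule holomorphic_transform) (auto simp: q_def)
    ultimately show ?thesis using z False by blast
  next
    case True
    define P1 where "P1 x = (if x = z then deriv P z else (P x - P z) / (x - z))" for x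
    define Q1 where "Q1 x = (if x = z then deriv Q z else (Q x - Q z) / (x - z))" for x
    have hol1: "P1 holomorphic_on S" "Q1 holomorphic_on S"
      unfolding P1_def[abs_def] Q1_def[abs_def] by (intro pole_lemma_open P Q S)+
    let ?T = "S \<inter> Q1 -` (- {0})"
    have T: "open ?T"
      using holomorphic_on_imp_continuous_on[OF hol1(2)] S by (intro continuous_open_preimage) auto
    have zT: "z \<in> ?T" using z simple[OF z True] by (simp add: Q1_def)
    have "(\<lambda>x. P1 x / Q1 x) holomorphic_on ?T"
      using hol1 by (intro holomorphic_intros) (auto intro: holomorphic_on_subset)
    moreover have "P1 x / Q1 x = q x" if "x \<in> ?T" for x
      using that True simple[OF z True] by (auto simp: P1_def Q1_def q_def split: if_splits)
    ultimately have "q holomorphic_on ?T"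
      by (rule holomorphic_transform)
    then show ?thesis using T zT by blast
  qed
  then have "q holomorphic_on S"
    by (metis S holomorphic_on_def holomorphic_on_imp_differentiable_at field_differentiable_at_within)
  moreover have "P z = q z * Q z" if "z \<in> S" for z
    using simple[OF that] by (auto simp: q_def)
  ultimately show ?thesis by blast
qed

text \<open>
  The logarithmic derivative of a nonconstant function has a pole at each zero. With
  \<open>g w = (w - z)\<^sup>n u w\<close>, cancelling \<open>(w - z)\<^sup>n\<^sup>-\<^sup>1\<close> in the assumed inequality and letting \<open>w\<close>
  tend to \<open>z\<close> gives \<open>n u z = 0\<close>.
\<close>

lemma not_bounded_by_multiple_of_self:
  assumes g: "g holomorphic_on ball z e" and e: "0 < e"
    and bd: "\<And>w. w \<in> ball z e \<Longrightarrow> norm (deriv g w) \<le> M * norm (g w)" and g0: "g z = 0"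
  shows "g constant_on ball z e"
proof (rule ccontr)
  assume nc: "\<not> g constant_on ball z e"
  obtain u r n where n: "0 < n" and r: "0 < r" "ball z r \<subseteq> ball z e"
    and u: "u holomorphic_on ball z r"
    and fac: "\<And>w. w \<in> ball z r \<Longrightarrow> g w = (w - z) ^ n * u w"
    and unz: "\<And>w. w \<in> ball z r \<Longrightarrow> u w \<noteq> 0"
    using holomorphic_factor_zero_nonconstant[OF g open_ball connected_ball _ g0 nc] e
    by (metis centre_in_ball)
  have dg: "deriv g w = (w - z) ^ (n - 1) * (of_nat n * u w + (w - z) * deriv u w)"
    if w: "w \<in> ball z r" for w
  proof -
    have "(u has_field_derivative deriv u w) (at w)"
      using holomorphic_derivI[OF u open_ball w] .
    moreover have "((\<lambda>x. (x - z) ^ n) has_field_derivative of_nat n * (w - z) ^ (n - 1)) (at w)"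
      by (auto intro!: derivative_eq_intros)
    ultimately have "((\<lambda>x. (x - z) ^ n * u x) has_field_derivative
        of_nat n * (w - z) ^ (n - 1) * u w + deriv u w * (w - z) ^ n) (at w)"
      by (rule DERIV_mult[rotated])
    moreover have "(w - z) ^ n = (w - z) ^ (n - 1) * (w - z)"
      using n by (metis power_minus_mult)
    ultimately have "((\<lambda>x. (x - z) ^ n * u x) has_field_derivative
        (w - z) ^ (n - 1) * (of_nat n * u w + (w - z) * deriv u w)) (at w)"
      by (simp add: algebra_simps)
    then have "(g has_field_derivative
        (w - z) ^ (n - 1) * (of_nat n * u w + (w - z) * deriv u w)) (at w)"
      by (rule has_field_derivative_transform_within_open[OF _ open_ball w]) (simp add: fac)
    then show ?thesis by (rule DERIV_imp_deriv)
  qed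
  have cu: "isCont u z" "isCont (deriv u) z"
    using holomorphic_on_imp_differentiable_at[OF u open_ball]
      holomorphic_on_imp_differentiable_at[OF holomorphic_deriv[OF u open_ball] open_ball] r(1)
    by (auto intro!: field_differentiable_imp_continuous_at)
  have "norm (of_nat n * u w + (w - z) * deriv u w) \<le> M * norm ((w - z) * u w)"
    if w: "w \<in> ball z r" "w \<noteq> z" for w
  proof -
    have "norm (deriv g w) \<le> M * norm (g w)"
      using bd w r by blast
    then have "norm (w - z) ^ (n - 1) * norm (of_nat n * u w + (w - z) * deriv u w)
        \<le> norm (w - z) ^ (n - 1) * (M * norm ((w - z) * u w))"
      unfolding dg[OF w(1)] fac[OF w(1)] power_minus_mult[OF n, symmetric]
      by (simp add: norm_mult norm_power mult_ac)
    then show ?thesis using w by simp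
  qed
  then have "\<forall>\<^sub>F w in at z. norm (of_nat n * u w + (w - z) * deriv u w) \<le> M * norm ((w - z) * u w)"
    using r(1) unfolding eventually_at by (auto simp: dist_commute intro!: exI[of _ r])
  moreover have "((\<lambda>w. norm (of_nat n * u w + (w - z) * deriv u w)) \<longlongrightarrow>
      norm (of_nat n * u z + (z - z) * deriv u z)) (at z)"
    using cu by (intro tendsto_intros) (auto simp: isCont_def)
  moreover have "((\<lambda>w. M * norm ((w - z) * u w)) \<longlongrightarrow> M * norm ((z - z) * u z)) (at z)"
    using cu by (intro tendsto_intros) (auto simp: isCont_def)
  ultimately have "norm (of_nat n * u z) \<le> 0"
    using tendsto_le[OF at_neq_bot] by fastforce
  then show False using unz[of z] r n by simp
qed

text \<open>
  A sequence whose derivative takes the same nonzero value at all \<open>b\<close>-points cannot lose its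
  \<open>b\<close>-points by letting them coalesce in the limit. The point is that
  \<open>q = (deriv (f n) - c n) / (f n - b)\<close> is holomorphic; on a small circle around \<open>z\<close> it is bounded
  uniformly in \<open>n\<close> because \<open>g - b\<close> has no zeros there, hence also in the disc by the maximum
  principle. In the limit \<open>deriv g\<close> is bounded by a multiple of \<open>g - b\<close> near \<open>z\<close>, which is
  impossible if \<open>g z = b\<close>.
\<close>

lemma limit_omits_value:
  assumes lim: "uniform_limit (ball z e) f g sequentially" and e: "0 < e"
    and hol: "\<forall>\<^sub>F n in sequentially. f n holomorphic_on ball z e"
    and holg: "g holomorphic_on ball z e"
    and share: "\<forall>\<^sub>F n in sequentially. \<forall>w\<in>ball z e. f n w = b \<longrightarrow> deriv (f n) w = c n"
    and c: "\<And>n. c n \<noteq> 0" "c \<longlonglongrightarrow> 0"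
    and nc: "\<not> g constant_on ball z e"
  shows "g z \<noteq> b"
proof
  assume gz: "g z = b"
  have holgb: "(\<lambda>w. g w - b) holomorphic_on ball z e"
    by (intro holomorphic_intros holg)
  have "\<exists>\<beta>\<in>ball z e. g \<beta> \<noteq> b"
    using nc by (auto simp: constant_on_def)
  then obtain \<beta> where \<beta>: "\<beta> \<in> ball z e" "g \<beta> - b \<noteq> 0" by auto
  have "z \<in> ball z e" "g z - b = 0" using e gz by auto
  then obtain s where s: "0 < s" "ball z s \<subseteq> ball z e"
    and iso: "\<And>w. w \<in> ball z s - {z} \<Longrightarrow> g w - b \<noteq> 0"
    using isolated_zeros[OF holgb open_ball connected_ball _ _ \<beta>] by metis
  define r where "r = min s (e / 2) / 2"
  have r: "0 < r" "r < s" "r < e / 2" using s e by (auto simp: r_def)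
  have sub: "cball z r \<subseteq> ball z (e / 2)" "cball z r \<subseteq> ball z e" using r by auto
  have cont: "continuous_on (cball z r) (\<lambda>w. g w - b)"
    by (rule continuous_on_subset[OF holomorphic_on_imp_continuous_on[OF holgb] sub(2)])
  have "\<exists>m>0. \<forall>w\<in>sphere z r. m \<le> norm (g w - b)"
  proof -
    have "continuous_on (sphere z r) (\<lambda>w. norm (g w - b))"
      by (intro continuous_on_norm continuous_on_subset[OF cont]) auto
    moreover have "sphere z r \<noteq> {}" using r by simp
    ultimately obtain x where "x \<in> sphere z r" "\<And>w. w \<in> sphere z r \<Longrightarrow> norm (g x - b) \<le> norm (g w - b)"
      using continuous_attains_inf[OF compact_sphere] by blast
    moreover from this(1) have "0 < norm (g x - b)" using iso[of x] r by auto
    ultimately show ?thesis by blast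
  qed
  then obtain m where m: "0 < m" "\<And>w. w \<in> sphere z r \<Longrightarrow> m \<le> norm (g w - b)" by blast
  have holdg: "deriv g holomorphic_on ball z e" by (intro holomorphic_deriv holg open_ball)
  have "compact (deriv g ` cball z r)"
    by (intro compact_continuous_image compact_cball
        continuous_on_subset[OF holomorphic_on_imp_continuous_on[OF holdg] sub(2)])
  from compact_imp_bounded[OF this] have "\<exists>G. \<forall>w\<in>cball z r. norm (deriv g w) \<le> G"
    by (simp add: bounded_iff)
  then obtain G where G: "\<And>w. w \<in> cball z r \<Longrightarrow> norm (deriv g w) \<le> G" by blast
  \<comment> \<open>on the circle, \<open>G + 2\<close> and \<open>m / 2\<close> will bound numerator and denominator of the quotient for large \<open>n\<close>\<close>
  define M where "M = (G + 2) / (m / 2)"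
  have limd: "uniform_limit (ball z (e / 2)) (\<lambda>n. deriv (f n)) (deriv g) sequentially"
    by (rule uniform_limit_deriv[OF lim hol holg e])
  have "\<forall>\<^sub>F n in sequentially. \<forall>w\<in>ball z e. dist (f n w) (g w) < m / 2"
    by (rule uniform_limitD[OF lim]) (use m in simp)
  moreover have "\<forall>\<^sub>F n in sequentially. \<forall>w\<in>ball z (e / 2). dist (deriv (f n) w) (deriv g w) < 1"
    by (rule uniform_limitD[OF limd]) simp
  moreover have "\<forall>\<^sub>F n in sequentially. dist (c n) 0 < 1"
    by (rule tendstoD[OF c(2)]) simp
  ultimately have bound: "\<forall>\<^sub>F n in sequentially. \<forall>w\<in>cball z r.
      norm (deriv (f n) w - c n) \<le> M * norm (f n w - b)"
    using hol share
  proof eventually_elim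
    case (elim n)
    have hf: "f n holomorphic_on ball z e" by fact
    have "\<exists>q. q holomorphic_on ball z e \<and> (\<forall>w\<in>ball z e. deriv (f n) w - c n = q w * (f n w - b))"
    proof (rule holomorphic_divisible_by_simple_zeros)
      show "deriv (f n) w - c n = 0 \<and> deriv (\<lambda>w. f n w - b) w \<noteq> 0"
        if "w \<in> ball z e" "f n w - b = 0" for w
      proof -
        have "deriv (\<lambda>w. f n w - b) w = deriv (f n) w"
          using holomorphic_on_imp_differentiable_at[OF hf open_ball that(1)]
          by (subst deriv_diff) auto
        then show ?thesis using that elim(5) c(1)[of n] by auto
      qed
    qed (auto intro!: holomorphic_intros holomorphic_deriv hf)
    then obtain q where q: "q holomorphic_on ball z e"
      "\<And>w. w \<in> ball z e \<Longrightarrow> deriv (f n) w - c n = q w * (f n w - b)" by blast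
    have sph: "norm (q w) \<le> M" if w: "w \<in> sphere z r" for w
    proof -
      have wb: "w \<in> ball z e" "w \<in> ball z (e / 2)" "w \<in> cball z r" using w r by auto
      have "norm (deriv (f n) w - c n) \<le> norm (deriv (f n) w - deriv g w) + norm (deriv g w) + norm (c n)"
        by norm
      then have num: "norm (deriv (f n) w - c n) \<le> G + 2"
        using elim(2,3) wb G[OF wb(3)] by (fastforce simp: dist_norm)
      have "m \<le> norm (g w - b)" "norm (f n w - g w) < m / 2"
        using m(2)[OF w] elim(1) wb by (auto simp: dist_norm)
      moreover have "norm (g w - b) \<le> norm (f n w - g w) + norm (f n w - b)" by norm
      ultimately have den: "m / 2 \<le> norm (f n w - b)" by linarith
      have "norm (q w) * (m / 2) \<le> norm (q w) * norm (f n w - b)"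
        using den by (intro mult_left_mono) auto
      also have "\<dots> \<le> G + 2"
        using num q(2)[OF wb(1)] by (simp add: norm_mult)
      finally show ?thesis unfolding M_def using m(1) by (simp add: field_simps)
    qed
    show ?case
    proof
      fix w assume w: "w \<in> cball z r"
      have "norm (q w) \<le> M"
      proof (rule maximum_modulus_frontier[of q "cball z r"])
        show "q holomorphic_on interior (cball z r)"
          using holomorphic_on_subset[OF q(1) sub(2)]
          by (rule holomorphic_on_subset) (rule interior_subset)
        show "continuous_on (closure (cball z r)) q"
          using holomorphic_on_imp_continuous_on[OF holomorphic_on_subset[OF q(1) sub(2)]] by simp
      qed (use sph w in auto)
      then show "norm (deriv (f n) w - c n) \<le> M * norm (f n w - b)"
        using q(2)[OF subsetD[OF sub(2) w]] by (simp add: norm_mult mult_right_mono)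
    qed
  qed
  have "norm (deriv (\<lambda>x. g x - b) w) \<le> M * norm (g w - b)" if w: "w \<in> ball z r" for w
  proof -
    have wb: "w \<in> ball z e" "w \<in> ball z (e / 2)" "w \<in> cball z r" using w r by auto
    have "(\<lambda>n. norm (deriv (f n) w - c n)) \<longlonglongrightarrow> norm (deriv g w - 0)"
      by (intro tendsto_intros c tendsto_uniform_limitI[OF limd] wb)
    moreover have "(\<lambda>n. M * norm (f n w - b)) \<longlonglongrightarrow> M * norm (g w - b)"
      by (intro tendsto_intros tendsto_uniform_limitI[OF lim] wb)
    moreover have "\<forall>\<^sub>F n in sequentially. norm (deriv (f n) w - c n) \<le> M * norm (f n w - b)"
      using bound wb by (auto elim: eventually_mono)
    ultimately have "norm (deriv g w - 0) \<le> M * norm (g w - b)"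
      by (intro tendsto_le[OF sequentially_bot])
    moreover have "deriv (\<lambda>x. g x - b) w = deriv g w"
      using holomorphic_on_imp_differentiable_at[OF holg open_ball wb(1)]
      by (subst deriv_diff) auto
    ultimately show ?thesis by simp
  qed
  then have "(\<lambda>x. g x - b) constant_on ball z r"
    using holgb sub r gz
    by (intro not_bounded_by_multiple_of_self[of _ z r M]) (auto intro: holomorphic_on_subset)
  moreover have "z + of_real (r / 2) \<in> ball z r" "z \<in> ball z r"
    using r by (auto simp: dist_norm)
  ultimately have "g (z + of_real (r / 2)) - b = g z - b"
    unfolding constant_on_def by metis
  moreover have "z + of_real (r / 2) \<in> ball z s - {z}"
    using r by (auto simp: dist_norm)
  ultimately show False using iso gz by simp
qed

text \<open>
  If \<open>deriv g z\<close> were not 0, then for large \<open>n\<close> the derivative of \<open>f n\<close> would be bounded away from 0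
  near \<open>z\<close>. As it is small at the \<open>a\<close>-points, \<open>f n\<close> would have no \<open>a\<close>-points there, and by Hurwitz's
  theorem neither would \<open>g\<close>.
\<close>

lemma limit_ramified_value:
  assumes lim: "uniform_limit (ball z e) f g sequentially" and e: "0 < e"
    and hol: "\<forall>\<^sub>F n in sequentially. f n holomorphic_on ball z e"
    and holg: "g holomorphic_on ball z e"
    and share: "\<forall>\<^sub>F n in sequentially. \<forall>w\<in>ball z e. f n w = a \<longrightarrow> norm (deriv (f n) w) \<le> \<eta> n"
    and \<eta>: "\<eta> \<longlonglongrightarrow> 0"
    and nc: "\<And>r. 0 < r \<Longrightarrow> \<not> g constant_on ball z r"
    and gz: "g z = a"
  shows "deriv g z = 0"
proof (rule ccontr)
  assume d: "deriv g z \<noteq> 0"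
  define \<delta> where "\<delta> = norm (deriv g z) / 3"
  have \<delta>: "0 < \<delta>" using d by (simp add: \<delta>_def)
  have holdg: "deriv g holomorphic_on ball z e" by (intro holomorphic_deriv holg open_ball)
  have "isCont (deriv g) z"
    using holomorphic_on_imp_continuous_on[OF holdg] e by (simp add: continuous_on_interior)
  then obtain s where s: "0 < s" "\<And>w. dist w z < s \<Longrightarrow> dist (deriv g w) (deriv g z) < \<delta>"
    unfolding continuous_at_eps_delta using \<delta> by blast
  define r where "r = min s (e / 2)"
  have r: "0 < r" "ball z r \<subseteq> ball z (e / 2)" "ball z r \<subseteq> ball z e" using s e by (auto simp: r_def)
  have limd: "uniform_limit (ball z (e / 2)) (\<lambda>n. deriv (f n)) (deriv g) sequentially"
    by (rule uniform_limit_deriv[OF lim hol holg e])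
  have "\<forall>\<^sub>F n in sequentially. \<forall>w\<in>ball z (e / 2). dist (deriv (f n) w) (deriv g w) < \<delta>"
    by (rule uniform_limitD[OF limd \<delta>])
  moreover have "\<forall>\<^sub>F n in sequentially. dist (\<eta> n) 0 < \<delta>"
    by (rule tendstoD[OF \<eta> \<delta>])
  ultimately have "\<forall>\<^sub>F n in sequentially. f n holomorphic_on ball z r \<and> (\<forall>w\<in>ball z r. f n w \<noteq> a)"
    using hol share
  proof eventually_elim
    case (elim n)
    have "f n w \<noteq> a" if w: "w \<in> ball z r" for w
    proof
      assume "f n w = a"
      then have "norm (deriv (f n) w) < \<delta>" using elim w r by fastforce
      moreover have "dist (deriv (f n) w) (deriv g w) < \<delta>" using elim w r by auto
      moreover have "dist (deriv g w) (deriv g z) < \<delta>"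
        using s(2)[of w] w by (simp add: r_def dist_commute)
      moreover have "norm (deriv g z) \<le> norm (deriv (f n) w) + dist (deriv (f n) w) (deriv g w)
          + dist (deriv g w) (deriv g z)"
        by norm
      ultimately show False by (simp add: \<delta>_def)
    qed
    then show ?case using elim(3) r by (auto intro: holomorphic_on_subset)
  qed
  then obtain N where N: "\<And>n. N \<le> n \<Longrightarrow> f n holomorphic_on ball z r"
    "\<And>n w. N \<le> n \<Longrightarrow> w \<in> ball z r \<Longrightarrow> f n w \<noteq> a"
    unfolding eventually_sequentially by blast
  have limN: "uniform_limit (ball z r) (\<lambda>n w. f (n + N) w - a) (\<lambda>w. g w - a) sequentially"
  proof (rule uniform_limitI)
    fix \<epsilon> :: real assume "0 < \<epsilon>"
    from uniform_limitD[OF lim this]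
    have "\<forall>\<^sub>F n in sequentially. \<forall>w\<in>ball z e. dist (f (n + N) w) (g w) < \<epsilon>"
      by (rule sequentially_offset)
    then show "\<forall>\<^sub>F n in sequentially. \<forall>w\<in>ball z r. dist (f (n + N) w - a) (g w - a) < \<epsilon>"
      by (rule eventually_mono) (use r in \<open>auto simp: dist_norm\<close>)
  qed
  have "g z - a \<noteq> 0"
  proof (rule Hurwitz_no_zeros[of "ball z r" "\<lambda>n w. f (n + N) w - a" "\<lambda>w. g w - a"])
    show "(\<lambda>w. g w - a) holomorphic_on ball z r"
      using holg r by (intro holomorphic_intros) (auto intro: holomorphic_on_subset)
    show "\<not> (\<lambda>w. g w - a) constant_on ball z r"
      using nc[OF r(1)] unfolding constant_on_def by (metis diff_eq_eq)
  qed (use N r in \<open>auto intro!: holomorphic_intros intro: uniform_limit_on_subset[OF limN]\<close>)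
  then show False using gz by simp
qed

section \<open>Marty's criterion\<close>

text \<open>
  Half of the length distortion of \<open>f\<close> as a map into the unit sphere; the constant factor 2 is
  left out.
\<close>

definition spherical_deriv :: "(complex \<Rightarrow> complex) \<Rightarrow> complex \<Rightarrow> real" where
  "spherical_deriv f z = norm (deriv f z) / (1 + (norm (f z))\<^sup>2)"

lemma spherical_deriv_nonneg: "0 \<le> spherical_deriv f z"
  by (simp add: spherical_deriv_def)

lemma norm_deriv_eq_spherical_deriv:
  "norm (deriv f z) = spherical_deriv f z * (1 + (norm (f z))\<^sup>2)"
proof -
  have "1 + (norm (f z))\<^sup>2 \<noteq> 0"
    using zero_le_power2[of "norm (f z)"] by linarith
  then show ?thesis by (simp add: spherical_deriv_def)
qed

text \<open>
  A function with bounded spherical derivative cannot pass from modulus 1/2 to modulus 1 over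
  a short distance, since as long as its modulus is below 1 its derivative is at most \<open>2 B\<close>.
  Therefore on a small disc it stays away from infinity or from 0. This replaces equicontinuity with
  respect to the spherical metric and reduces Marty's criterion to Montel's theorem.
\<close>

lemma spherical_deriv_dichotomy:
  assumes holf: "f holomorphic_on ball z d"
    and bd: "\<And>w. w \<in> ball z d \<Longrightarrow> spherical_deriv f w \<le> B"
    and dB: "8 * B * d \<le> 1" and B: "0 < B"
  shows "(\<forall>w\<in>ball z d. norm (f w) \<le> 1) \<or> (\<forall>w\<in>ball z d. 1 / 2 \<le> norm (f w))"
proof (rule ccontr)
  assume "\<not> ?thesis"
  then obtain u v where u: "u \<in> ball z d" "norm (f u) < 1 / 2" and v: "v \<in> ball z d" "1 < norm (f v)"
    by (meson not_le)
  define x where "x t = u + of_real t * (v - u)" for t :: real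
  have x01: "x 0 = u" "x 1 = v" by (auto simp: x_def)
  have xb: "x t \<in> ball z d" if "t \<in> {0..1}" for t
  proof -
    have "x t = (1 - t) *\<^sub>R u + t *\<^sub>R v" by (simp add: x_def scaleR_conv_of_real algebra_simps)
    then show ?thesis using convexD_alt[OF convex_ball u(1) v(1), of t] that by simp
  qed
  have contx: "continuous_on {0..1} x" unfolding x_def by (intro continuous_intros)
  have contfx: "continuous_on {0..1} (\<lambda>t. f (x t))"
    using continuous_on_compose2[OF holomorphic_on_imp_continuous_on[OF holf] contx] xb by blast
  \<comment> \<open>follow the segment from \<open>u\<close> to \<open>v\<close> up to the first time at which the modulus reaches 1\<close>
  define T where "T = {t \<in> {0..1}. 1 \<le> norm (f (x t))}"
  have "closed ({0..1} \<inter> (\<lambda>t. norm (f (x t))) -` {1..})"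
    by (intro continuous_closed_preimage continuous_intros contfx)
  moreover have "{0..1} \<inter> (\<lambda>t. norm (f (x t))) -` {1..} = T"
    by (auto simp: T_def)
  ultimately have "closed T" by simp
  moreover have "T = {0..1} \<inter> T" by (auto simp: T_def)
  ultimately have "compact T" by (metis compact_Icc compact_Int_closed)
  moreover have "1 \<in> T" using v by (simp add: T_def x01)
  ultimately have "\<exists>\<tau>\<in>T. \<forall>t\<in>T. \<tau> \<le> t"
    by (intro compact_attains_inf) auto
  then obtain \<tau> where \<tau>: "\<tau> \<in> T" and first: "\<And>t. t \<in> T \<Longrightarrow> \<tau> \<le> t" by blast
  have \<tau>01: "0 < \<tau>" "\<tau> \<le> 1"
    using \<tau> u(2) x01 by (auto simp: T_def le_less)
  have small: "norm (f (x t)) < 1" if "0 < t" "t < \<tau>" for t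
  proof -
    have "t \<notin> T" using first[of t] that by linarith
    then show ?thesis using that \<tau>01 by (simp add: T_def not_le)
  qed
  have der: "((\<lambda>t. f (x t)) has_derivative (\<lambda>h. of_real h * (deriv f (x t) * (v - u)))) (at t)"
    if "0 < t" "t < \<tau>" for t
  proof -
    have "(f has_field_derivative deriv f (x t)) (at (x t))"
      using holomorphic_derivI[OF holf open_ball xb] that \<tau>01 by simp
    moreover have "(x has_derivative (\<lambda>h. of_real h * (v - u))) (at t)"
      unfolding x_def[abs_def] by (auto intro!: derivative_eq_intros)
    ultimately show ?thesis
      unfolding has_field_derivative_def
      using diff_chain_at[of x "\<lambda>h. of_real h * (v - u)" t f "(*) (deriv f (x t))"]
      by (simp add: o_def mult_ac)
  qed
  obtain t where t: "0 < t" "t < \<tau>"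
    and mvt: "norm (f (x \<tau>) - f (x 0)) \<le> norm (of_real (\<tau> - 0) * (deriv f (x t) * (v - u)))"
    using mvt_general[OF \<tau>01(1) continuous_on_subset[OF contfx] der] \<tau>01 by auto
  have "norm (deriv f (x t)) \<le> B * 2"
  proof -
    have "spherical_deriv f (x t) \<le> B" using bd xb t \<tau>01 by simp
    moreover have "1 + (norm (f (x t)))\<^sup>2 \<le> 2"
      using small[OF t] by (simp add: power_le_one)
    ultimately show ?thesis
      unfolding norm_deriv_eq_spherical_deriv
      by (intro mult_mono) (use B in auto)
  qed
  moreover have "norm (v - u) < 2 * d"
    using u v dist_triangle_less_add[of v z d u d] by (simp add: dist_norm norm_minus_commute)
  ultimately have "norm (deriv f (x t)) * norm (v - u) \<le> (B * 2) * (2 * d)"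
    using B by (intro mult_mono) auto
  moreover have "norm (of_real (\<tau> - 0) * (deriv f (x t) * (v - u))) \<le> 1 * (norm (deriv f (x t)) * norm (v - u))"
    unfolding norm_mult norm_of_real using \<tau>01 by (intro mult_right_mono) auto
  ultimately have "norm (f (x \<tau>) - f (x 0)) \<le> 1 / 2" using mvt dB by (simp add: algebra_simps)
  then have "norm (f (x \<tau>)) < 1"
    using u(2) norm_triangle_sub[of "f (x \<tau>)" "f (x 0)"] by (simp add: x01)
  then show False using \<tau> by (simp add: T_def)
qed

definition diverges_uniformly :: "complex set \<Rightarrow> (nat \<Rightarrow> complex \<Rightarrow> complex) \<Rightarrow> bool" where
  "diverges_uniformly S f \<longleftrightarrow> (\<forall>M. \<forall>\<^sub>F n in sequentially. \<forall>w\<in>S. M \<le> norm (f n w))"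

definition converges_or_diverges :: "complex set \<Rightarrow> (nat \<Rightarrow> complex \<Rightarrow> complex) \<Rightarrow> bool" where
  "converges_or_diverges S f \<longleftrightarrow> (\<exists>g. uniform_limit S f g sequentially) \<or> diverges_uniformly S f"

lemma Montel_bounded_ball:
  assumes hol: "\<And>n. f n holomorphic_on ball z d"
    and bd: "\<And>n w. w \<in> ball z d \<Longrightarrow> norm (f n w) \<le> B"
  obtains g r where "g holomorphic_on ball z d" "strict_mono (r :: nat \<Rightarrow> nat)"
    "\<And>K. compact K \<Longrightarrow> K \<subseteq> ball z d \<Longrightarrow> uniform_limit K (\<lambda>n. f (r n)) g sequentially"
proof -
  obtain g r where "g holomorphic_on ball z d" "strict_mono (r :: nat \<Rightarrow> nat)"
    "\<And>x. x \<in> ball z d \<Longrightarrow> ((\<lambda>n. f (r n) x) \<longlongrightarrow> g x) sequentially"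
    "\<And>K. compact K \<Longrightarrow> K \<subseteq> ball z d \<Longrightarrow> uniform_limit K (f \<circ> r) g sequentially"
  proof (rule Montel[of "ball z d" "range f" f])
    show "\<And>h. h \<in> range f \<Longrightarrow> h holomorphic_on ball z d" using hol by blast
    show "\<exists>B. \<forall>h\<in>range f. \<forall>w\<in>K. norm (h w) \<le> B" if "compact K" "K \<subseteq> ball z d" for K
      using that bd by blast
  qed auto
  then show ?thesis using that by (simp add: o_def)
qed

text \<open>
  Montel's theorem applies to the reciprocals. By Hurwitz's theorem their limit either has no
  zeros, and inverting gives convergence of the functions, or vanishes identically, and then the
  functions tend to infinity. Passing to the disc of half the radius makes the limits uniform.
\<close>

lemma subsequence_large_values:
  assumes hol: "\<And>n. f n holomorphic_on ball z d" and d: "0 < d"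
    and large: "\<And>n w. w \<in> ball z d \<Longrightarrow> 1 / 2 \<le> norm (f n w)"
  shows "\<exists>r. strict_mono (r :: nat \<Rightarrow> nat) \<and> converges_or_diverges (ball z (d / 2)) (\<lambda>n. f (r n))"
proof -
  let ?K = "cball z (d / 2)"
  have K: "?K \<subseteq> ball z d" using d by auto
  have nz: "f n w \<noteq> 0" if "w \<in> ball z d" for n w
    using large[OF that, of n] by auto
  have holi: "(\<lambda>w. inverse (f n w)) holomorphic_on ball z d" for n
    using nz by (intro holomorphic_intros hol) auto
  have "norm (inverse (f n w)) \<le> 2" if "w \<in> ball z d" for n w
  proof -
    have "inverse (norm (f n w)) \<le> inverse (1 / 2)"
      by (rule le_imp_inverse_le[OF large[OF that]]) simp
    then show ?thesis by (simp only: norm_inverse) simp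
  qed
  then obtain g r where g: "g holomorphic_on ball z d" and r: "strict_mono (r :: nat \<Rightarrow> nat)"
    and lim: "\<And>K. compact K \<Longrightarrow> K \<subseteq> ball z d \<Longrightarrow>
        uniform_limit K (\<lambda>n w. inverse (f (r n) w)) g sequentially"
    using Montel_bounded_ball[of "\<lambda>n w. inverse (f n w)" z d 2] holi by blast
  have limK: "uniform_limit ?K (\<lambda>n w. inverse (f (r n) w)) g sequentially"
    by (rule lim[OF compact_cball K])
  have "converges_or_diverges (ball z (d / 2)) (\<lambda>n. f (r n))"
  proof (cases "\<forall>w\<in>ball z d. g w \<noteq> 0")
    case True
    have "continuous_on ?K (\<lambda>w. norm (g w))"
      by (intro continuous_intros continuous_on_subset[OF holomorphic_on_imp_continuous_on[OF g] K])
    moreover have "?K \<noteq> {}" using d by simp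
    ultimately obtain x where x: "x \<in> ?K" "\<And>w. w \<in> ?K \<Longrightarrow> norm (g x) \<le> norm (g w)"
      using continuous_attains_inf[OF compact_cball] by blast
    have "0 < norm (g x)" using True x K by auto
    from uniform_lim_inverse[OF limK x(2) this]
    have "uniform_limit ?K (\<lambda>n w. f (r n) w) (inverse \<circ> g) sequentially" by simp
    then show ?thesis
      unfolding converges_or_diverges_def
      using uniform_limit_on_subset ball_subset_cball by blast
  next
    case False
    have "g constant_on ball z d"
    proof (rule ccontr)
      assume nc: "\<not> g constant_on ball z d"
      have "g w \<noteq> 0" if w: "w \<in> ball z d" for w
        by (rule Hurwitz_no_zeros[OF open_ball connected_ball, where \<F> = "\<lambda>n w. inverse (f (r n) w)"])
           (use holi g lim nc nz w in auto)
      then show False using False by blast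
    qed
    then have g0: "g w = 0" if "w \<in> ball z d" for w
      using False that unfolding constant_on_def by metis
    have "\<forall>\<^sub>F n in sequentially. \<forall>w\<in>ball z (d / 2). M \<le> norm (f (r n) w)" for M
    proof -
      have "0 < 1 / (\<bar>M\<bar> + 1)" by simp
      from uniform_limitD[OF limK this] show ?thesis
      proof (rule eventually_mono)
        fix n assume *: "\<forall>w\<in>?K. dist (inverse (f (r n) w)) (g w) < 1 / (\<bar>M\<bar> + 1)"
        show "\<forall>w\<in>ball z (d / 2). M \<le> norm (f (r n) w)"
        proof
          fix w assume w: "w \<in> ball z (d / 2)"
          then have wb: "w \<in> ball z d" "w \<in> ?K" using d by auto
          have "inverse (norm (f (r n) w)) < inverse (\<bar>M\<bar> + 1)"
            using bspec[OF * wb(2)] g0[OF wb(1)] by (simp add: norm_divide inverse_eq_divide)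
          then have "\<bar>M\<bar> + 1 < norm (f (r n) w)"
            by (rule inverse_less_imp_less) (use nz[OF wb(1)] in auto)
          then show "M \<le> norm (f (r n) w)" by linarith
        qed
      qed
    qed
    then show ?thesis unfolding converges_or_diverges_def diverges_uniformly_def by blast
  qed
  with r show ?thesis by blast
qed

text \<open>
  Only the tail of the sequence has to be defined and holomorphic near a given point. This is
  what rescaled functions satisfy, whose domains merely exhaust the plane.
\<close>

definition locally_bounded_spherical_deriv :: "complex set \<Rightarrow> (nat \<Rightarrow> complex \<Rightarrow> complex) \<Rightarrow> bool" where
  "locally_bounded_spherical_deriv S f \<longleftrightarrow>
     (\<forall>z\<in>S. \<exists>e>0. \<exists>B. ball z e \<subseteq> S \<and>
        (\<forall>\<^sub>F n in sequentially. f n holomorphic_on ball z e \<and>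
           (\<forall>w\<in>ball z e. spherical_deriv (f n) w \<le> B)))"

text \<open>
  On a disc so small that the dichotomy applies, infinitely many members of the sequence are
  bounded by 1 or infinitely many are bounded below by 1/2.
\<close>

lemma locally_bounded_spherical_deriv_imp_local_subsequences:
  assumes "locally_bounded_spherical_deriv S f" and z: "z \<in> S"
  shows "\<exists>d>0. ball z d \<subseteq> S \<and> (\<forall>s. strict_mono (s :: nat \<Rightarrow> nat) \<longrightarrow>
     (\<exists>r. strict_mono (r :: nat \<Rightarrow> nat) \<and> converges_or_diverges (ball z d) (\<lambda>n. f (s (r n)))))"
proof -
  obtain e B where e: "0 < e" "ball z e \<subseteq> S"
    and ev: "\<forall>\<^sub>F n in sequentially. f n holomorphic_on ball z e \<and> (\<forall>w\<in>ball z e. spherical_deriv (f n) w \<le> B)"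
    using assms unfolding locally_bounded_spherical_deriv_def by blast
  then obtain N where N: "\<And>n. N \<le> n \<Longrightarrow> f n holomorphic_on ball z e"
    "\<And>n w. N \<le> n \<Longrightarrow> w \<in> ball z e \<Longrightarrow> spherical_deriv (f n) w \<le> B"
    unfolding eventually_sequentially by blast
  define C where "C = \<bar>B\<bar> + 1"
  define d where "d = min e (1 / (8 * C))"
  have C: "0 < C" by (simp add: C_def)
  have d: "0 < d" "ball z d \<subseteq> ball z e" using e C by (auto simp: d_def)
  have dC: "8 * C * d \<le> 1"
  proof -
    have "8 * C * d \<le> 8 * C * (1 / (8 * C))" using C by (intro mult_left_mono) (auto simp: d_def)
    then show ?thesis using C by simp
  qed
  have dich: "(\<forall>w\<in>ball z d. norm (f n w) \<le> 1) \<or> (\<forall>w\<in>ball z d. 1 / 2 \<le> norm (f n w))" if n: "N \<le> n" for n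
  proof (rule spherical_deriv_dichotomy[OF _ _ dC C])
    show "f n holomorphic_on ball z d" using N(1)[OF n] d(2) by (rule holomorphic_on_subset)
    show "spherical_deriv (f n) w \<le> C" if "w \<in> ball z d" for w
      using N(2)[OF n, of w] that d by (auto simp: C_def)
  qed
  have "\<exists>r. strict_mono (r :: nat \<Rightarrow> nat) \<and> converges_or_diverges (ball z (d / 2)) (\<lambda>n. f (s (r n)))"
    if s: "strict_mono s" for s :: "nat \<Rightarrow> nat"
  proof (cases "infinite {n. N \<le> n \<and> (\<forall>w\<in>ball z d. norm (f (s n) w) \<le> 1)}")
    case True
    then obtain k where k: "strict_mono (k :: nat \<Rightarrow> nat)"
      and kN: "\<And>n. N \<le> k n" and small: "\<And>n w. w \<in> ball z d \<Longrightarrow> norm (f (s (k n)) w) \<le> 1"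
      using infinite_enumerate[OF True] by auto
    have "N \<le> s (k n)" for n using kN[of n] seq_suble[OF s, of "k n"] by linarith
    then have hol: "f (s (k n)) holomorphic_on ball z d" for n
      using N(1) d(2) holomorphic_on_subset by blast
    obtain g r where r: "strict_mono (r :: nat \<Rightarrow> nat)"
      and lim: "\<And>K. compact K \<Longrightarrow> K \<subseteq> ball z d \<Longrightarrow> uniform_limit K (\<lambda>n. f (s (k (r n)))) g sequentially"
      using Montel_bounded_ball[of "\<lambda>n. f (s (k n))" z d 1] hol small by metis
    have "uniform_limit (ball z (d / 2)) (\<lambda>n. f (s (k (r n)))) g sequentially"
      by (rule uniform_limit_on_subset[OF lim[of "cball z (d / 2)"]]) (use d(1) in auto)
    then show ?thesis
      using strict_mono_o[OF k r] unfolding converges_or_diverges_def o_def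
      by (intro exI[of _ "\<lambda>n. k (r n)"]) blast
  next
    case False
    let ?A = "{n. N \<le> n \<and> (\<forall>w\<in>ball z d. norm (f (s n) w) \<le> 1)}"
    have "infinite ({N..} - ?A)" using False by (intro Diff_infinite_finite infinite_Ici) auto
    from infinite_enumerate[OF this]
    obtain k where k: "strict_mono (k :: nat \<Rightarrow> nat)" and kA: "\<And>n. k n \<in> {N..} - ?A"
      by blast
    have kN: "N \<le> s (k n)" for n using kA[of n] seq_suble[OF s, of "k n"] by auto
    then have hol: "f (s (k n)) holomorphic_on ball z d" for n
      using N(1) d(2) holomorphic_on_subset by blast
    have large: "1 / 2 \<le> norm (f (s (k n)) w)" if "w \<in> ball z d" for n w
      using dich[OF kN[of n]] kA[of n] that by auto
    obtain r where r: "strict_mono (r :: nat \<Rightarrow> nat)"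
      and "converges_or_diverges (ball z (d / 2)) (\<lambda>n. f (s (k (r n))))"
      using subsequence_large_values[of "\<lambda>n. f (s (k n))" z d] hol d large by blast
    then show ?thesis
      using strict_mono_o[OF k r] unfolding o_def by (intro exI[of _ "\<lambda>n. k (r n)"]) blast
  qed
  moreover have "ball z (d / 2) \<subseteq> S"
    using d e subset_ball[of "d / 2" d z] by auto
  ultimately show ?thesis using d by (intro exI[of _ "d / 2"]) auto
qed

definition locally_convergent_to :: "complex set \<Rightarrow> (nat \<Rightarrow> complex \<Rightarrow> complex) \<Rightarrow> (complex \<Rightarrow> complex) \<Rightarrow> bool" where
  "locally_convergent_to S f g \<longleftrightarrow>
     (\<forall>z\<in>S. \<exists>e>0. ball z e \<subseteq> S \<and> uniform_limit (ball z e) f g sequentially)"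

definition locally_divergent :: "complex set \<Rightarrow> (nat \<Rightarrow> complex \<Rightarrow> complex) \<Rightarrow> bool" where
  "locally_divergent S f \<longleftrightarrow> (\<forall>z\<in>S. \<exists>e>0. ball z e \<subseteq> S \<and> diverges_uniformly (ball z e) f)"

lemma diverges_uniformly_subset:
  assumes "diverges_uniformly S f" "T \<subseteq> S"
  shows "diverges_uniformly T f"
  unfolding diverges_uniformly_def
proof
  fix M
  have "\<forall>\<^sub>F n in sequentially. \<forall>w\<in>S. M \<le> norm (f n w)"
    using assms(1) by (simp add: diverges_uniformly_def)
  then show "\<forall>\<^sub>F n in sequentially. \<forall>w\<in>T. M \<le> norm (f n w)"
    by (rule eventually_mono) (use assms(2) in blast)
qed

lemma converges_or_diverges_subset:
  assumes "converges_or_diverges S f" "T \<subseteq> S"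
  shows "converges_or_diverges T f"
  using assms uniform_limit_on_subset diverges_uniformly_subset
  unfolding converges_or_diverges_def by blast

lemma converges_or_diverges_subsequence:
  assumes "converges_or_diverges S f" "strict_mono (r :: nat \<Rightarrow> nat)"
  shows "converges_or_diverges S (\<lambda>n. f (r n))"
proof -
  have "\<exists>g. uniform_limit S (\<lambda>n. f (r n)) g sequentially" if "uniform_limit S f g sequentially" for g
    using filterlim_compose[OF that filterlim_subseq[OF assms(2)]] by blast
  moreover have "diverges_uniformly S (\<lambda>n. f (r n))" if "diverges_uniformly S f"
    using that eventually_subseq[OF assms(2)] unfolding diverges_uniformly_def by blast
  ultimately show ?thesis
    using assms(1) unfolding converges_or_diverges_def by blast
qed

lemma converges_or_diverges_shift:
  assumes "converges_or_diverges S (\<lambda>n. f (n + k))"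
  shows "converges_or_diverges S f"
proof -
  have "uniform_limit S f g sequentially" if "uniform_limit S (\<lambda>n. f (n + k)) g sequentially" for g
  proof (rule uniform_limitI)
    fix e :: real assume "0 < e"
    then have "\<forall>\<^sub>F n in sequentially. \<forall>w\<in>S. dist (f (n + k) w) (g w) < e"
      by (rule uniform_limitD[OF that])
    then show "\<forall>\<^sub>F n in sequentially. \<forall>w\<in>S. dist (f n w) (g w) < e"
      by (rule eventually_sequentially_seg[THEN iffD1])
  qed
  moreover have "diverges_uniformly S f" if "diverges_uniformly S (\<lambda>n. f (n + k))"
    unfolding diverges_uniformly_def
  proof
    fix M
    have "\<forall>\<^sub>F n in sequentially. \<forall>w\<in>S. M \<le> norm (f (n + k) w)"
      using that by (simp only: diverges_uniformly_def)
    then show "\<forall>\<^sub>F n in sequentially. \<forall>w\<in>S. M \<le> norm (f n w)"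
      by (rule eventually_sequentially_seg[THEN iffD1])
  qed
  ultimately show ?thesis
    using assms unfolding converges_or_diverges_def by blast
qed

text \<open>
  Countably many of the discs cover \<open>S\<close> by Lindelof's theorem, and a diagonal sequence serves all
  of them at once.
\<close>

lemma diagonal_converges_or_diverges:
  assumes loc: "\<And>z. z \<in> S \<Longrightarrow> \<exists>d>0. ball z d \<subseteq> S \<and> (\<forall>s. strict_mono (s :: nat \<Rightarrow> nat) \<longrightarrow>
     (\<exists>r. strict_mono (r :: nat \<Rightarrow> nat) \<and> converges_or_diverges (ball z d) (\<lambda>n. f (s (r n)))))"
  shows "\<exists>r. strict_mono (r :: nat \<Rightarrow> nat) \<and>
     (\<forall>z\<in>S. \<exists>e>0. ball z e \<subseteq> S \<and> converges_or_diverges (ball z e) (\<lambda>n. f (r n)))"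
proof (cases "S = {}")
  case True
  then show ?thesis using strict_mono_id by blast
next
  case False
  have "\<exists>d. \<forall>z\<in>S. 0 < d z \<and> ball z (d z) \<subseteq> S \<and> (\<forall>s. strict_mono (s :: nat \<Rightarrow> nat) \<longrightarrow>
     (\<exists>r. strict_mono (r :: nat \<Rightarrow> nat) \<and> converges_or_diverges (ball z (d z)) (\<lambda>n. f (s (r n)))))"
    by (intro bchoice ballI loc)
  then obtain d where *: "\<forall>z\<in>S. 0 < d z \<and> ball z (d z) \<subseteq> S \<and> (\<forall>s. strict_mono (s :: nat \<Rightarrow> nat) \<longrightarrow>
     (\<exists>r. strict_mono (r :: nat \<Rightarrow> nat) \<and> converges_or_diverges (ball z (d z)) (\<lambda>n. f (s (r n)))))" ..
  have d: "0 < d z" "ball z (d z) \<subseteq> S" if "z \<in> S" for z using * that by auto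
  have sub: "\<exists>r. strict_mono (r :: nat \<Rightarrow> nat) \<and> converges_or_diverges (ball z (d z)) (\<lambda>n. f (s (r n)))"
    if "z \<in> S" "strict_mono s" for z and s :: "nat \<Rightarrow> nat"
    using * that by simp
  obtain \<C> where \<C>: "\<C> \<subseteq> (\<lambda>z. ball z (d z)) ` S" "countable \<C>" "\<Union>\<C> = \<Union>((\<lambda>z. ball z (d z)) ` S)"
    using Lindelof[of "(\<lambda>z. ball z (d z)) ` S"] by blast
  have cover: "S \<subseteq> \<Union>\<C>" using \<C>(3) d(1) by auto
  have "\<C> \<noteq> {}" using cover False by auto
  define b where "b = from_nat_into \<C>"
  have b: "\<exists>z\<in>S. b n = ball z (d z)" for n
    using from_nat_into[OF \<open>\<C> \<noteq> {}\<close>, of n] \<C>(1) by (auto simp: b_def)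
  have rb: "range b = \<C>" using \<open>\<C> \<noteq> {}\<close> \<C>(2) by (simp add: b_def)
  interpret subseqs "\<lambda>n r. converges_or_diverges (b n) (\<lambda>i. f (r i))"
  proof
    fix n and s :: "nat \<Rightarrow> nat" assume "strict_mono s"
    moreover obtain z where "z \<in> S" "b n = ball z (d z)" using b by blast
    ultimately show "\<exists>r'. strict_mono r' \<and> converges_or_diverges (b n) (\<lambda>i. f ((s \<circ> r') i))"
      using sub[of z s] by simp
  qed
  have "converges_or_diverges (b k) (\<lambda>i. f ((diagseq \<circ> (+) (Suc k)) i))" for k
  proof (rule diagseq_holds)
    fix r s :: "nat \<Rightarrow> nat" and n
    assume "strict_mono r" "converges_or_diverges (b n) (\<lambda>i. f (s i))"
    then show "converges_or_diverges (b n) (\<lambda>i. f ((s \<circ> r) i))"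
      using converges_or_diverges_subsequence[of "b n" "\<lambda>i. f (s i)" r] by simp
  qed
  \<comment> \<open>the diagonal sequence is a subsequence of the \<open>k\<close>-th one only from index \<open>Suc k\<close> on\<close>
  then have "converges_or_diverges (b k) (\<lambda>i. f (diagseq (i + Suc k)))" for k
    by (simp only: o_apply add.commute)
  then have conv: "converges_or_diverges (b k) (\<lambda>i. f (diagseq i))" for k
    by (rule converges_or_diverges_shift)
  have "\<exists>e>0. ball z e \<subseteq> S \<and> converges_or_diverges (ball z e) (\<lambda>n. f (diagseq n))" if z: "z \<in> S" for z
  proof -
    obtain k where k: "z \<in> b k" using cover z rb by blast
    obtain y where y: "y \<in> S" "b k = ball y (d y)" using b by blast
    have "open (b k)" using y(2) by simp
    then obtain e where e: "0 < e" "ball z e \<subseteq> b k" using k by (rule openE)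
    then have "converges_or_diverges (ball z e) (\<lambda>n. f (diagseq n))"
      using converges_or_diverges_subset[OF conv] by blast
    then show ?thesis using e d(2)[OF y(1)] y by auto
  qed
  then show ?thesis using subseq_diagseq by blast
qed

text \<open>
  The points near which the extracted sequence converges and the points near which it tends to
  infinity form two disjoint open sets that cover \<open>S\<close>. As \<open>S\<close> is connected, one of them is all of \<open>S\<close>.
\<close>

theorem Marty_subsequence:
  assumes S: "open S" "connected S" and bdd: "locally_bounded_spherical_deriv S f"
  shows "\<exists>r. strict_mono (r :: nat \<Rightarrow> nat) \<and>
    ((\<exists>g. g holomorphic_on S \<and> locally_convergent_to S (\<lambda>n. f (r n)) g) \<or> locally_divergent S (\<lambda>n. f (r n)))"
proof -
  obtain r where r: "strict_mono (r :: nat \<Rightarrow> nat)"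
    and alt: "\<And>z. z \<in> S \<Longrightarrow> \<exists>e>0. ball z e \<subseteq> S \<and> converges_or_diverges (ball z e) (\<lambda>n. f (r n))"
    using diagonal_converges_or_diverges[of S f]
      locally_bounded_spherical_deriv_imp_local_subsequences[OF bdd] by blast
  define F where "F n = f (r n)" for n
  define U where "U = {z. \<exists>e>0. ball z e \<subseteq> S \<and> (\<exists>g. uniform_limit (ball z e) F g sequentially)}"
  define V where "V = {z. \<exists>e>0. ball z e \<subseteq> S \<and> diverges_uniformly (ball z e) F}"
  have smaller: "\<exists>e'>0. ball w e' \<subseteq> ball z e" if "w \<in> ball z e" for w z and e :: real
    using that open_ball openE by blast
  have "open U"
    unfolding open_contains_ball
  proof
    fix z assume "z \<in> U"
    then obtain e g where e: "0 < e" "ball z e \<subseteq> S" "uniform_limit (ball z e) F g sequentially"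
      by (auto simp: U_def)
    have "w \<in> U" if w: "w \<in> ball z e" for w
    proof -
      obtain e' where e': "0 < e'" "ball w e' \<subseteq> ball z e" using smaller[OF w] by blast
      then have "ball w e' \<subseteq> S" "uniform_limit (ball w e') F g sequentially"
        using e uniform_limit_on_subset[OF e(3) e'(2)] by auto
      then show ?thesis unfolding U_def using e'(1) by blast
    qed
    then show "\<exists>e>0. ball z e \<subseteq> U" using e(1) by blast
  qed
  moreover have "open V"
    unfolding open_contains_ball
  proof
    fix z assume "z \<in> V"
    then obtain e where e: "0 < e" "ball z e \<subseteq> S" "diverges_uniformly (ball z e) F"
      by (auto simp: V_def)
    have "w \<in> V" if w: "w \<in> ball z e" for w
    proof -
      obtain e' where e': "0 < e'" "ball w e' \<subseteq> ball z e" using smaller[OF w] by blast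
      then have "ball w e' \<subseteq> S" "diverges_uniformly (ball w e') F"
        using e diverges_uniformly_subset[OF e(3) e'(2)] by auto
      then show ?thesis unfolding V_def using e'(1) by blast
    qed
    then show "\<exists>e>0. ball z e \<subseteq> V" using e(1) by blast
  qed
  moreover have "U \<inter> V = {}"
  proof -
    have False if zU: "z \<in> U" and zV: "z \<in> V" for z
    proof -
      obtain e g where e: "0 < e" "uniform_limit (ball z e) F g sequentially"
        using zU by (auto simp: U_def)
      have "\<forall>\<^sub>F n in sequentially. \<forall>w\<in>ball z e. dist (F n w) (g w) < 1"
        by (rule uniform_limitD[OF e(2)]) simp
      then have "\<forall>\<^sub>F n in sequentially. dist (F n z) (g z) < 1"
        by (rule eventually_mono) (use e in auto)
      moreover have "\<forall>\<^sub>F n in sequentially. norm (g z) + 1 \<le> norm (F n z)"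
        using zV unfolding V_def diverges_uniformly_def by (fastforce elim: eventually_mono)
      ultimately have "\<forall>\<^sub>F n in sequentially. False"
      proof eventually_elim
        case (elim n)
        then show ?case using norm_triangle_ineq2[of "F n z" "g z"] by (simp add: dist_norm)
      qed
      then show False by simp
    qed
    then show ?thesis by blast
  qed
  moreover have "S \<subseteq> U \<union> V"
    using alt unfolding U_def V_def converges_or_diverges_def F_def by blast
  ultimately have "U \<inter> S = {} \<or> V \<inter> S = {}"
    by (intro connectedD[OF S(2)]) auto
  with \<open>S \<subseteq> U \<union> V\<close> have "S \<subseteq> U \<or> S \<subseteq> V" by blast
  then have "(\<exists>g. g holomorphic_on S \<and> locally_convergent_to S F g) \<or> locally_divergent S F"
  proof
    assume SU: "S \<subseteq> U"
    define g where "g z = lim (\<lambda>n. F n z)" for z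
    have loc: "\<exists>e>0. ball z e \<subseteq> S \<and> uniform_limit (ball z e) F g sequentially" if z: "z \<in> S" for z
    proof -
      obtain e h where e: "0 < e" "ball z e \<subseteq> S" "uniform_limit (ball z e) F h sequentially"
        using SU z by (auto simp: U_def)
      have eq: "g w = h w" if "w \<in> ball z e" for w
        unfolding g_def by (rule limI[OF tendsto_uniform_limitI[OF e(3) that]])
      have "uniform_limit (ball z e) F g sequentially"
        by (rule uniform_limitI) (use uniform_limitD[OF e(3)] in \<open>simp add: eq\<close>)
      then show ?thesis using e by blast
    qed
    have "g field_differentiable at z" if z: "z \<in> S" for z
    proof -
      obtain e where e: "0 < e" "ball z e \<subseteq> S" "uniform_limit (ball z e) F g sequentially"
        using loc[OF z] by blast
      obtain e' B where e': "0 < e'"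
        and "\<forall>\<^sub>F n in sequentially. f n holomorphic_on ball z e' \<and> (\<forall>w\<in>ball z e'. spherical_deriv (f n) w \<le> B)"
        using bdd z unfolding locally_bounded_spherical_deriv_def by blast
      then have holF: "\<forall>\<^sub>F n in sequentially. F n holomorphic_on ball z e'"
        unfolding F_def by (intro eventually_subseq[OF r]) (auto elim: eventually_mono)
      define \<rho> where "\<rho> = min e e' / 2"
      have \<rho>: "0 < \<rho>" "cball z \<rho> \<subseteq> ball z e" "cball z \<rho> \<subseteq> ball z e'"
        using e e' by (auto simp: \<rho>_def)
      have "g holomorphic_on ball z \<rho>"
      proof (rule holomorphic_uniform_limit[of z \<rho> F sequentially g])
        show "\<forall>\<^sub>F n in sequentially. continuous_on (cball z \<rho>) (F n) \<and> F n holomorphic_on ball z \<rho>"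
          using holF
        proof eventually_elim
          case (elim n)
          have "F n holomorphic_on cball z \<rho>" using elim \<rho>(3) by (rule holomorphic_on_subset)
          then show ?case
            using holomorphic_on_imp_continuous_on holomorphic_on_subset ball_subset_cball by blast
        qed
      qed (use e \<rho> in \<open>auto intro: uniform_limit_on_subset\<close>)
      then show ?thesis using \<rho> holomorphic_on_imp_differentiable_at[OF _ open_ball] by auto
    qed
    then have "g holomorphic_on S"
      by (auto simp: holomorphic_on_def intro: field_differentiable_at_within)
    then show ?thesis using loc unfolding locally_convergent_to_def by blast
  next
    assume "S \<subseteq> V"
    then show ?thesis unfolding locally_divergent_def V_def by blast
  qed
  then show ?thesis using r unfolding F_def by blast
qed

section \<open>Zalcman's rescaling\<close>

lemma spherical_deriv_rescale:
  assumes f: "f field_differentiable at (w + of_real \<rho> * \<zeta>)" and \<rho>: "0 < \<rho>"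
  shows "deriv (\<lambda>\<zeta>. f (w + of_real \<rho> * \<zeta>)) \<zeta> = of_real \<rho> * deriv f (w + of_real \<rho> * \<zeta>)"
    and "spherical_deriv (\<lambda>\<zeta>. f (w + of_real \<rho> * \<zeta>)) \<zeta> = \<rho> * spherical_deriv f (w + of_real \<rho> * \<zeta>)"
proof -
  have "(f has_field_derivative deriv f (w + of_real \<rho> * \<zeta>)) (at (w + of_real \<rho> * \<zeta>))"
    using f by (simp add: field_differentiable_derivI)
  then have "((\<lambda>\<zeta>. f (w + of_real \<rho> * \<zeta>)) has_field_derivative
      deriv f (w + of_real \<rho> * \<zeta>) * of_real \<rho>) (at \<zeta>)"
    by (rule DERIV_chain2) (auto intro!: derivative_eq_intros)
  then show *: "deriv (\<lambda>\<zeta>. f (w + of_real \<rho> * \<zeta>)) \<zeta> = of_real \<rho> * deriv f (w + of_real \<rho> * \<zeta>)"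
    by (simp add: DERIV_imp_deriv mult.commute)
  show "spherical_deriv (\<lambda>\<zeta>. f (w + of_real \<rho> * \<zeta>)) \<zeta> = \<rho> * spherical_deriv f (w + of_real \<rho> * \<zeta>)"
    unfolding spherical_deriv_def * using \<rho> by (simp add: norm_mult)
qed

lemma continuous_on_spherical_deriv:
  assumes "f holomorphic_on S" "open S"
  shows "continuous_on S (spherical_deriv f)"
proof -
  have "1 + (norm (f z))\<^sup>2 \<noteq> 0" for z
    using zero_le_power2[of "norm (f z)"] by linarith
  then show ?thesis
    unfolding spherical_deriv_def[abs_def]
    using assms by (intro continuous_intros holomorphic_on_imp_continuous_on holomorphic_deriv) auto
qed

text \<open>
  The point \<open>w\<close> is chosen to maximise \<open>(r - \<bar>z - z0\<bar>) * spherical_deriv f z\<close>, not the spherical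
  derivative itself. The weight vanishes on the boundary, so the maximum is attained inside, and
  within half the distance from \<open>w\<close> to the boundary the weight drops by a factor of at most 2, so that
  there the spherical derivative is at most twice its value at \<open>w\<close>. Measured in units of \<open>\<rho>\<close>,
  this neighbourhood is large because the maximum is.
\<close>

lemma Zalcman_rescaling_point:
  assumes holf: "f holomorphic_on S" and S: "open S" "cball z0 r \<subseteq> S" and r: "0 < r"
    and x: "x \<in> ball z0 (r / 2)" and k: "0 < k" "k \<le> spherical_deriv f x"
  obtains w \<rho> where "0 < \<rho>" "\<rho> \<le> 2 / k" "\<rho> * spherical_deriv f w = 1"
    "\<And>\<zeta>. norm \<zeta> \<le> r * k / 4 \<Longrightarrow> w + of_real \<rho> * \<zeta> \<in> ball z0 r"
    "\<And>\<zeta>. norm \<zeta> \<le> r * k / 4 \<Longrightarrow> \<rho> * spherical_deriv f (w + of_real \<rho> * \<zeta>) \<le> 2"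
proof -
  define \<mu> where "\<mu> z = (r - norm (z - z0)) * spherical_deriv f z" for z
  have "continuous_on (cball z0 r) \<mu>"
    unfolding \<mu>_def
    by (intro continuous_intros continuous_on_subset[OF continuous_on_spherical_deriv[OF holf S(1)] S(2)])
  moreover have "cball z0 r \<noteq> {}" using r by simp
  ultimately obtain w where w: "w \<in> cball z0 r" and max: "\<And>z. z \<in> cball z0 r \<Longrightarrow> \<mu> z \<le> \<mu> w"
    using continuous_attains_sup[OF compact_cball] by blast
  have xn: "norm (x - z0) < r / 2" using x by (simp add: dist_norm norm_minus_commute)
  have "r / 2 * k \<le> (r - norm (x - z0)) * spherical_deriv f x"
    using xn k r by (intro mult_mono) auto
  also have "\<dots> \<le> \<mu> w"
    using max[of x] xn r by (simp add: \<mu>_def dist_norm norm_minus_commute)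
  finally have big: "r * k / 2 \<le> \<mu> w" by simp
  have rk: "0 < r * k" using r k by simp
  \<comment> \<open>\<open>R\<close> is the weight at \<open>w\<close>; the estimate \<open>r * k / 2 \<le> R * s\<close> is where the radius \<open>r * k / 4\<close> comes from\<close>
  define R where "R = r - norm (w - z0)"
  define s where "s = spherical_deriv f w"
  have \<mu>w: "\<mu> w = R * s" by (simp add: \<mu>_def R_def s_def)
  have R0: "0 \<le> R" using w by (simp add: R_def dist_norm norm_minus_commute)
  have Rs: "0 < R * s" using big rk unfolding \<mu>w by linarith
  then have R: "0 < R" and s: "0 < s"
    using R0 by (auto simp: zero_less_mult_iff)
  define \<rho> where "\<rho> = 1 / s"
  have \<rho>: "0 < \<rho>" using s by (simp add: \<rho>_def)
  have Rr: "R \<le> r" by (simp add: R_def)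
  have near: "norm (w + of_real \<rho> * \<zeta> - z0) \<le> r - R / 2" if "norm \<zeta> \<le> r * k / 4" for \<zeta>
  proof -
    have "norm \<zeta> \<le> R * s / 2" using that big unfolding \<mu>w by simp
    then have "norm (of_real \<rho> * \<zeta>) \<le> R / 2"
      unfolding norm_mult norm_of_real using s by (simp add: \<rho>_def divide_le_eq mult_ac)
    moreover have "norm (w + of_real \<rho> * \<zeta> - z0) \<le> norm (w - z0) + norm (of_real \<rho> * \<zeta>)"
      by (metis add_diff_eq add.commute diff_add_eq norm_triangle_ineq)
    ultimately show ?thesis unfolding R_def by argo
  qed
  show ?thesis
  proof (rule that[of \<rho> w])
    show "0 < \<rho>" by fact
    show "\<rho> * spherical_deriv f w = 1" using s by (simp add: \<rho>_def s_def)
    have "r * k / 2 \<le> r * s"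
      using big Rr s unfolding \<mu>w by (meson less_imp_le mult_right_mono order_trans)
    then have "k / 2 \<le> s" using r by simp
    then show "\<rho> \<le> 2 / k" using k s by (simp add: \<rho>_def field_simps)
    fix \<zeta> :: complex assume \<zeta>: "norm \<zeta> \<le> r * k / 4"
    let ?z = "w + of_real \<rho> * \<zeta>"
    show "?z \<in> ball z0 r"
      using near[OF \<zeta>] R by (simp add: dist_norm norm_minus_commute)
    then have "\<mu> ?z \<le> \<mu> w" by (intro max) auto
    moreover have "R / 2 * spherical_deriv f ?z \<le> \<mu> ?z"
      unfolding \<mu>_def using near[OF \<zeta>] by (intro mult_right_mono spherical_deriv_nonneg) simp
    ultimately have "R * (spherical_deriv f ?z) \<le> R * (2 * s)" unfolding \<mu>w by simp
    then have "spherical_deriv f ?z \<le> 2 * s" using R by simp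
    then show "\<rho> * spherical_deriv f ?z \<le> 2"
      using s by (simp add: \<rho>_def divide_le_eq)
  qed
qed

lemma spherical_deriv_tendsto:
  assumes lim: "locally_convergent_to S f g" and z: "z \<in> S"
    and bdd: "locally_bounded_spherical_deriv S f"
  shows "(\<lambda>n. spherical_deriv (f n) z) \<longlonglongrightarrow> spherical_deriv g z"
proof -
  obtain e where e: "0 < e" "uniform_limit (ball z e) f g sequentially"
    using lim z unfolding locally_convergent_to_def by blast
  obtain e' B where e': "0 < e'"
    and ev: "\<forall>\<^sub>F n in sequentially. f n holomorphic_on ball z e' \<and> (\<forall>w\<in>ball z e'. spherical_deriv (f n) w \<le> B)"
    using bdd z unfolding locally_bounded_spherical_deriv_def by blast
  let ?U = "ball z (min e e')"
  have ulim: "uniform_limit ?U f g sequentially"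
    using e(2) by (rule uniform_limit_on_subset) auto
  have hol: "\<forall>\<^sub>F n in sequentially. f n holomorphic_on ?U"
    using ev by (rule eventually_mono) (auto elim!: holomorphic_on_subset)
  have zU: "z \<in> ?U" using e(1) e' by simp
  have "(\<lambda>n. deriv (f n) z) \<longlonglongrightarrow> deriv g z"
    by (rule deriv_complex_uniform_limit[OF ulim hol sequentially_bot open_ball zU])
  moreover have "(\<lambda>n. f n z) \<longlonglongrightarrow> g z"
    by (rule tendsto_uniform_limitI[OF ulim zU])
  moreover have "1 + (norm (g z))\<^sup>2 \<noteq> 0"
    using zero_le_power2[of "norm (g z)"] by linarith
  ultimately show ?thesis
    unfolding spherical_deriv_def by (intro tendsto_intros)
qed

text \<open>
  The spherical derivative is invariant under \<open>v \<mapsto> 1 / v\<close>, and the reciprocals tend uniformly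
  to 0, hence so do their derivatives.
\<close>

lemma spherical_deriv_locally_divergent:
  assumes div: "locally_divergent S f" and z: "z \<in> S"
    and bdd: "locally_bounded_spherical_deriv S f"
  shows "\<forall>\<^sub>F n in sequentially. spherical_deriv (f n) z < 1"
proof -
  obtain e where e: "0 < e" "diverges_uniformly (ball z e) f"
    using div z unfolding locally_divergent_def by blast
  obtain e' B where e': "0 < e'"
    and ev: "\<forall>\<^sub>F n in sequentially. f n holomorphic_on ball z e' \<and> (\<forall>w\<in>ball z e'. spherical_deriv (f n) w \<le> B)"
    using bdd z unfolding locally_bounded_spherical_deriv_def by blast
  define d where "d = min e e'"
  have d: "0 < d" "d \<le> e" "d \<le> e'" using e e' by (auto simp: d_def)
  have "\<forall>\<^sub>F n in sequentially. \<forall>w\<in>ball z e. 1 / d \<le> norm (f n w)"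
    using e(2) unfolding diverges_uniformly_def by blast
  with ev show ?thesis
  proof eventually_elim
    case (elim n)
    have big: "1 / d \<le> norm (f n w)" if "w \<in> ball z d" for w
      using elim(2) that d by auto
    have nz: "f n w \<noteq> 0" if "w \<in> ball z d" for w
      using big[OF that] d by auto
    have hol: "f n holomorphic_on ball z d"
      using elim(1) d by (auto intro: holomorphic_on_subset)
    have "norm (deriv (\<lambda>w. inverse (f n w)) z) \<le> d / d"
    proof (rule Cauchy_deriv_bound[OF _ _ d(1)])
      show "(\<lambda>w. inverse (f n w)) holomorphic_on ball z d"
        using nz by (intro holomorphic_intros hol) auto
      show "norm (inverse (f n w)) \<le> d" if "w \<in> ball z d" for w
      proof -
        have "inverse (norm (f n w)) \<le> inverse (1 / d)"
          by (rule le_imp_inverse_le[OF big[OF that]]) (use d in simp)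
        then show ?thesis by (simp only: norm_inverse) simp
      qed
    qed
    moreover have "deriv (\<lambda>w. inverse (f n w)) z = - deriv (f n) z / (f n z)\<^sup>2"
    proof -
      have zd: "z \<in> ball z d" using d by simp
      have "(f n has_field_derivative deriv (f n) z) (at z)"
        using holomorphic_derivI[OF hol open_ball zd] .
      from DERIV_inverse_fun[OF this nz[OF zd]] show ?thesis
        by (simp add: DERIV_imp_deriv power2_eq_square divide_simps)
    qed
    ultimately have "norm (deriv (f n) z) / (norm (f n z))\<^sup>2 \<le> 1"
      using d(1) by (simp add: norm_divide norm_power)
    moreover have "0 < (norm (f n z))\<^sup>2" using nz[of z] d by simp
    ultimately have "norm (deriv (f n) z) < 1 + (norm (f n z))\<^sup>2"
      by (simp add: divide_le_eq)
    moreover have "0 < 1 + (norm (f n z))\<^sup>2" using \<open>0 < (norm (f n z))\<^sup>2\<close> by linarith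
    ultimately show ?case
      unfolding spherical_deriv_def by (simp only: divide_less_eq_1_pos)
  qed
qed

lemma locally_bounded_spherical_deriv_subsequence:
  assumes "locally_bounded_spherical_deriv S f" "strict_mono (r :: nat \<Rightarrow> nat)"
  shows "locally_bounded_spherical_deriv S (\<lambda>n. f (r n))"
  unfolding locally_bounded_spherical_deriv_def
proof
  fix z assume "z \<in> S"
  then obtain e B where e: "0 < e" "ball z e \<subseteq> S"
    and ev: "\<forall>\<^sub>F n in sequentially. f n holomorphic_on ball z e \<and> (\<forall>w\<in>ball z e. spherical_deriv (f n) w \<le> B)"
    using assms(1) unfolding locally_bounded_spherical_deriv_def by blast
  from eventually_subseq[OF assms(2) ev] e
  show "\<exists>e>0. \<exists>B. ball z e \<subseteq> S \<and> (\<forall>\<^sub>F n in sequentially. f (r n) holomorphic_on ball z e \<and>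
      (\<forall>w\<in>ball z e. spherical_deriv (f (r n)) w \<le> B))"
    by blast
qed

text \<open>
  At the points provided by \<open>Zalcman_rescaling_point\<close> the rescaled functions have spherical
  derivative 1 at the origin and at most 2 on discs that exhaust the plane, so Marty's criterion
  yields a subsequence. It cannot tend to infinity, because then the spherical derivative at the
  origin would drop below 1 (\<open>spherical_deriv_locally_divergent\<close>). The compact set \<open>K\<close> records that
  all the points used stay within a fixed part of \<open>D\<close>.
\<close>

theorem Zalcman:
  fixes F :: "(complex \<Rightarrow> complex) set"
  assumes D: "open D" and z0: "z0 \<in> D" and holF: "\<And>f. f \<in> F \<Longrightarrow> f holomorphic_on D"
    and unb: "\<And>e B. 0 < e \<Longrightarrow> \<exists>f\<in>F. \<exists>w\<in>ball z0 e. B < spherical_deriv f w"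
  obtains K f \<rho> w g where "compact K" "K \<subseteq> D" "\<forall>n::nat. f n \<in> F" "\<forall>n. 0 < (\<rho> n :: real)" "\<rho> \<longlonglongrightarrow> 0"
    "\<forall>R. \<forall>\<^sub>F n in sequentially. \<forall>\<zeta>\<in>ball 0 R. w n + of_real (\<rho> n) * \<zeta> \<in> K"
    "g holomorphic_on UNIV"
    "locally_convergent_to UNIV (\<lambda>n \<zeta>. f n (w n + of_real (\<rho> n) * \<zeta>)) g"
    "spherical_deriv g 0 = 1" "\<forall>\<zeta>. spherical_deriv g \<zeta> \<le> 2"
proof -
  obtain r where r: "0 < r" "cball z0 r \<subseteq> D"
    using D z0 open_contains_cball by blast
  have "\<exists>f w \<rho>. f \<in> F \<and> 0 < \<rho> \<and> \<rho> \<le> 2 / (real n + 1) \<and> \<rho> * spherical_deriv f w = 1 \<and>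
      (\<forall>\<zeta>. norm \<zeta> \<le> r * (real n + 1) / 4 \<longrightarrow> w + of_real \<rho> * \<zeta> \<in> ball z0 r \<and>
        \<rho> * spherical_deriv f (w + of_real \<rho> * \<zeta>) \<le> 2)" for n :: nat
  proof -
    obtain f x where f: "f \<in> F" and x: "x \<in> ball z0 (r / 2)" "real n + 1 < spherical_deriv f x"
      using unb[of "r / 2" "real n + 1"] r by auto
    show ?thesis
    proof (rule Zalcman_rescaling_point[OF holF[OF f] D r(2,1) x(1) _ less_imp_le[OF x(2)]])
      fix w \<rho>
      assume "0 < \<rho>" "\<rho> \<le> 2 / (real n + 1)" "\<rho> * spherical_deriv f w = 1"
        "\<And>\<zeta>. norm \<zeta> \<le> r * (real n + 1) / 4 \<Longrightarrow> w + of_real \<rho> * \<zeta> \<in> ball z0 r"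
        "\<And>\<zeta>. norm \<zeta> \<le> r * (real n + 1) / 4 \<Longrightarrow>
            \<rho> * spherical_deriv f (w + of_real \<rho> * \<zeta>) \<le> 2"
      then show ?thesis using f by blast
    qed simp
  qed
  then obtain f w \<rho> where f: "\<And>n. f n \<in> F" and \<rho>: "\<And>n. 0 < \<rho> n" "\<And>n. \<rho> n \<le> 2 / (real n + 1)"
    and one: "\<And>n. \<rho> n * spherical_deriv (f n) (w n) = 1"
    and inb: "\<And>n \<zeta>. norm \<zeta> \<le> r * (real n + 1) / 4 \<Longrightarrow> w n + of_real (\<rho> n) * \<zeta> \<in> ball z0 r"
    and two: "\<And>n \<zeta>. norm \<zeta> \<le> r * (real n + 1) / 4 \<Longrightarrow>
        \<rho> n * spherical_deriv (f n) (w n + of_real (\<rho> n) * \<zeta>) \<le> 2"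
    by metis
  define \<phi> where "\<phi> n \<zeta> = f n (w n + of_real (\<rho> n) * \<zeta>)" for n \<zeta>
  have ev: "\<forall>\<^sub>F n in sequentially. R \<le> r * (real n + 1) / 4" for R
    using r(1) by real_asymp
  have diff: "f n field_differentiable at (w n + of_real (\<rho> n) * \<zeta>)"
    if "norm \<zeta> \<le> r * (real n + 1) / 4" for n \<zeta>
  proof (rule holomorphic_on_imp_differentiable_at[OF holF[OF f] D])
    show "w n + of_real (\<rho> n) * \<zeta> \<in> D"
      using inb[OF that] r(2) by (meson ball_subset_cball subsetD)
  qed
  have hol: "\<phi> n holomorphic_on ball 0 R" if "R \<le> r * (real n + 1) / 4" for n R
    unfolding holomorphic_on_def
  proof
    fix \<zeta> :: complex assume "\<zeta> \<in> ball 0 R"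
    then have "norm \<zeta> \<le> r * (real n + 1) / 4" using that by simp
    note fd = diff[OF this]
    have "((\<lambda>\<zeta>. w n + of_real (\<rho> n) * \<zeta>) has_field_derivative of_real (\<rho> n)) (at \<zeta>)"
      by (auto intro!: derivative_eq_intros)
    then have "(\<lambda>\<zeta>. w n + of_real (\<rho> n) * \<zeta>) field_differentiable at \<zeta>"
      by (auto simp: field_differentiable_def)
    from field_differentiable_compose[OF this fd] have "\<phi> n field_differentiable at \<zeta>"
      by (simp add: o_def \<phi>_def[abs_def])
    then show "\<phi> n field_differentiable at \<zeta> within ball 0 R"
      by (rule field_differentiable_at_within)
  qed
  have sd: "spherical_deriv (\<phi> n) \<zeta> = \<rho> n * spherical_deriv (f n) (w n + of_real (\<rho> n) * \<zeta>)"
    if "norm \<zeta> \<le> r * (real n + 1) / 4" for n \<zeta>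
    unfolding \<phi>_def[abs_def] by (rule spherical_deriv_rescale(2)[OF diff[OF that] \<rho>(1)])
  have bdd: "locally_bounded_spherical_deriv UNIV \<phi>"
    unfolding locally_bounded_spherical_deriv_def
  proof
    fix z :: complex
    have sub: "ball z 1 \<subseteq> ball 0 (norm z + 1)"
    proof
      fix x assume "x \<in> ball z 1"
      then show "x \<in> ball 0 (norm z + 1)"
        using norm_triangle_ineq2[of x z] by (simp add: dist_norm norm_minus_commute)
    qed
    have "\<forall>\<^sub>F n in sequentially. \<phi> n holomorphic_on ball z 1 \<and> (\<forall>w\<in>ball z 1. spherical_deriv (\<phi> n) w \<le> 2)"
      using ev[of "norm z + 1"]
    proof eventually_elim
      case (elim n)
      have "\<phi> n holomorphic_on ball z 1" using hol[OF elim] sub by (rule holomorphic_on_subset)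
      moreover have "spherical_deriv (\<phi> n) x \<le> 2" if "x \<in> ball z 1" for x
      proof -
        have "norm x \<le> r * (real n + 1) / 4" using subsetD[OF sub that] elim by simp
        then show ?thesis using sd two by simp
      qed
      ultimately show ?case by blast
    qed
    then show "\<exists>e>0. \<exists>B. ball z e \<subseteq> UNIV \<and> (\<forall>\<^sub>F n in sequentially. \<phi> n holomorphic_on ball z e \<and>
        (\<forall>w\<in>ball z e. spherical_deriv (\<phi> n) w \<le> B))"
      by (intro exI[of _ 1] exI[of _ 2]) auto
  qed
  obtain s where s: "strict_mono (s :: nat \<Rightarrow> nat)"
    and alt: "(\<exists>g. g holomorphic_on UNIV \<and> locally_convergent_to UNIV (\<lambda>n. \<phi> (s n)) g) \<or>
        locally_divergent UNIV (\<lambda>n. \<phi> (s n))"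
    using Marty_subsequence[OF open_UNIV connected_UNIV bdd] by blast
  have bdds: "locally_bounded_spherical_deriv UNIV (\<lambda>n. \<phi> (s n))"
    by (rule locally_bounded_spherical_deriv_subsequence[OF bdd s])
  have at0: "spherical_deriv (\<phi> n) 0 = 1" for n
    using sd[of 0 n] one[of n] r(1) by simp
  have "\<not> locally_divergent UNIV (\<lambda>n. \<phi> (s n))"
  proof
    assume "locally_divergent UNIV (\<lambda>n. \<phi> (s n))"
    from spherical_deriv_locally_divergent[OF this UNIV_I bdds, of 0] show False
      by (simp add: at0)
  qed
  with alt obtain g where g: "g holomorphic_on UNIV" "locally_convergent_to UNIV (\<lambda>n. \<phi> (s n)) g"
    by blast
  show ?thesis
  proof (rule that[of "cball z0 r" "\<lambda>n. f (s n)" "\<lambda>n. \<rho> (s n)" "\<lambda>n. w (s n)" g])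
    show "(\<lambda>n. \<rho> (s n)) \<longlonglongrightarrow> 0"
    proof -
      have "(\<lambda>n. 2 / (real n + 1)) \<longlonglongrightarrow> 0" by real_asymp
      then have "\<rho> \<longlonglongrightarrow> 0"
        by (rule tendsto_sandwich[OF _ _ tendsto_const, rotated 2])
           (use \<rho> in \<open>auto intro!: always_eventually less_imp_le\<close>)
      from LIMSEQ_subseq_LIMSEQ[OF this s] show ?thesis by (simp add: o_def)
    qed
    have "\<forall>\<^sub>F n in sequentially. \<forall>\<zeta>\<in>ball 0 R. w (s n) + of_real (\<rho> (s n)) * \<zeta> \<in> cball z0 r" for R
      using eventually_subseq[OF s ev[of R]]
    proof eventually_elim
      case (elim n)
      show ?case
      proof
        fix \<zeta> :: complex assume "\<zeta> \<in> ball 0 R"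
        then have "norm \<zeta> \<le> r * (real (s n) + 1) / 4" using elim by simp
        from inb[OF this] show "w (s n) + of_real (\<rho> (s n)) * \<zeta> \<in> cball z0 r" by simp
      qed
    qed
    then show "\<forall>R. \<forall>\<^sub>F n in sequentially. \<forall>\<zeta>\<in>ball 0 R.
        w (s n) + of_real (\<rho> (s n)) * \<zeta> \<in> cball z0 r" ..
    show "locally_convergent_to UNIV (\<lambda>n \<zeta>. f (s n) (w (s n) + of_real (\<rho> (s n)) * \<zeta>)) g"
      using g(2) by (simp only: \<phi>_def[abs_def])
    have "(\<lambda>n. spherical_deriv (\<phi> (s n)) 0) \<longlonglongrightarrow> spherical_deriv g 0"
      by (rule spherical_deriv_tendsto[OF g(2) UNIV_I bdds])
    then show "spherical_deriv g 0 = 1"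
      unfolding at0 by (simp add: LIMSEQ_const_iff)
    have "spherical_deriv g \<zeta> \<le> 2" for \<zeta>
    proof (rule tendsto_upperbound[OF spherical_deriv_tendsto[OF g(2) UNIV_I bdds]])
      show "\<forall>\<^sub>F n in sequentially. spherical_deriv (\<phi> (s n)) \<zeta> \<le> 2"
        using eventually_subseq[OF s ev[of "norm \<zeta>"]]
        by (rule eventually_mono) (use sd two in simp)
    qed simp
    then show "\<forall>\<zeta>. spherical_deriv g \<zeta> \<le> 2" ..
  qed (use r g f \<rho> in auto)
qed

section \<open>The spherical metric\<close>

text \<open>
  The inner product of two unit vectors is one minus half their squared distance, so this is the
  usual formula for the chordal distance.
\<close>

lemma inner_sphere_point_finite:
  "sphere_point (Some u) \<bullet> sphere_point (Some v)
     = 1 - 2 * (norm (u - v))\<^sup>2 / ((1 + (norm u)\<^sup>2) * (1 + (norm v)\<^sup>2))"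
proof -
  have pos: "0 < 1 + (norm u)\<^sup>2" "0 < 1 + (norm v)\<^sup>2"
    by (simp_all add: add_pos_nonneg)
  have eq: "2 * (u \<bullet> v) = (norm u)\<^sup>2 + (norm v)\<^sup>2 - (norm (u - v))\<^sup>2"
    by (simp add: power2_norm_eq_inner inner_diff_left inner_diff_right inner_commute)
  have *: "4 * i / (x * y) + (x - 2) * (y - 2) / (x * y) = 1 - 2 * d / (x * y)"
    if "0 < x" "0 < y" "2 * i = (x - 1) + (y - 1) - d" for i x y d :: real
    using that by (simp add: divide_simps) (simp add: algebra_simps)
  have "sphere_point (Some z) = ((2 / (1 + (norm z)\<^sup>2)) *\<^sub>R z, (1 + (norm z)\<^sup>2 - 2) / (1 + (norm z)\<^sup>2))" for z
    by (simp add: sphere_point_def divide_inverse add.commute mult.commute)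
  then have "sphere_point (Some u) \<bullet> sphere_point (Some v)
      = 4 * (u \<bullet> v) / ((1 + (norm u)\<^sup>2) * (1 + (norm v)\<^sup>2))
        + ((1 + (norm u)\<^sup>2) - 2) * ((1 + (norm v)\<^sup>2) - 2) / ((1 + (norm u)\<^sup>2) * (1 + (norm v)\<^sup>2))"
    by (simp only: inner_Pair inner_scaleR_left inner_scaleR_right inner_real_def) (simp add: mult_ac)
  also have "\<dots> = 1 - 2 * (norm (u - v))\<^sup>2 / ((1 + (norm u)\<^sup>2) * (1 + (norm v)\<^sup>2))"
    by (rule *) (use pos eq in auto)
  finally show ?thesis .
qed

lemma inner_sphere_point_infinity:
  "sphere_point (Some u) \<bullet> sphere_point None = 1 - 2 / (1 + (norm u)\<^sup>2)"
proof -
  have "0 < 1 + (norm u)\<^sup>2" by (simp add: add_pos_nonneg)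
  then show ?thesis by (simp add: sphere_point_def inner_Pair field_simps)
qed

lemma small_spherical_dist:
  assumes "0 < \<epsilon>"
  obtains \<delta> where "0 < \<delta>"
    "\<And>p q. 1 - \<delta> \<le> sphere_point p \<bullet> sphere_point q \<Longrightarrow> sphere_point p \<bullet> sphere_point q \<le> 1 \<Longrightarrow>
       dist (spherical_dist p q) 0 < \<epsilon>"
proof
  define \<eta> where "\<eta> = min \<epsilon> 1 / 2"
  have \<eta>: "0 < \<eta>" "\<eta> < \<epsilon>" "\<eta> \<le> pi"
    using assms pi_ge_two by (auto simp: \<eta>_def)
  show "0 < 1 - cos \<eta>"
    using cos_monotone_0_pi[of 0 \<eta>] \<eta> by simp
  fix p q :: riemann_sphere
  assume *: "1 - (1 - cos \<eta>) \<le> sphere_point p \<bullet> sphere_point q" "sphere_point p \<bullet> sphere_point q \<le> 1"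
  have "spherical_dist p q \<le> arccos (cos \<eta>)"
    unfolding spherical_dist_def using * by (intro arccos_le_arccos) auto
  moreover have "0 \<le> spherical_dist p q"
    unfolding spherical_dist_def using *
    by (intro arccos_lbound) (auto intro: order_trans[OF cos_ge_minus_one])
  ultimately show "dist (spherical_dist p q) 0 < \<epsilon>"
    using \<eta> by (simp add: arccos_cos)
qed

lemma uniform_limit_spherical:
  assumes "uniform_limit S f g sequentially"
  shows "uniform_limit S (\<lambda>n w. spherical_dist (Some (f n w)) (Some (g w))) (\<lambda>_. 0) sequentially"
proof (rule uniform_limitI)
  fix \<epsilon> :: real assume "0 < \<epsilon>"
  then obtain \<delta> where \<delta>: "0 < \<delta>" and small:
    "\<And>p q. 1 - \<delta> \<le> sphere_point p \<bullet> sphere_point q \<Longrightarrow> sphere_point p \<bullet> sphere_point q \<le> 1 \<Longrightarrow>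
       dist (spherical_dist p q) 0 < \<epsilon>"
    by (rule small_spherical_dist) blast
  have "\<forall>\<^sub>F n in sequentially. \<forall>w\<in>S. dist (f n w) (g w) < sqrt (\<delta> / 2)"
    by (rule uniform_limitD[OF assms]) (use \<delta> in simp)
  then show "\<forall>\<^sub>F n in sequentially. \<forall>w\<in>S. dist (spherical_dist (Some (f n w)) (Some (g w))) 0 < \<epsilon>"
  proof (rule eventually_mono, intro ballI)
    fix n w assume "\<forall>w\<in>S. dist (f n w) (g w) < sqrt (\<delta> / 2)" and w: "w \<in> S"
    then have "norm (f n w - g w) \<le> sqrt (\<delta> / 2)" by (auto simp: dist_norm)
    then have "(norm (f n w - g w))\<^sup>2 \<le> (sqrt (\<delta> / 2))\<^sup>2"
      by (rule power_mono) simp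
    then have "2 * (norm (f n w - g w))\<^sup>2 \<le> \<delta>" using \<delta> by simp
    moreover have "2 * (norm (f n w - g w))\<^sup>2 / ((1 + (norm (f n w))\<^sup>2) * (1 + (norm (g w))\<^sup>2))
        \<le> 2 * (norm (f n w - g w))\<^sup>2 / 1"
    proof (rule divide_left_mono)
      show "1 \<le> (1 + (norm (f n w))\<^sup>2) * (1 + (norm (g w))\<^sup>2)"
        using mult_mono[of 1 "1 + (norm (f n w))\<^sup>2" 1 "1 + (norm (g w))\<^sup>2"] by simp
    qed (auto simp: add_pos_nonneg)
    ultimately show "dist (spherical_dist (Some (f n w)) (Some (g w))) 0 < \<epsilon>"
      by (intro small) (auto simp: inner_sphere_point_finite)
  qed
qed

lemma uniform_limit_spherical_infinity:
  assumes "diverges_uniformly S f"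
  shows "uniform_limit S (\<lambda>n w. spherical_dist (Some (f n w)) None) (\<lambda>_. 0) sequentially"
proof (rule uniform_limitI)
  fix \<epsilon> :: real assume "0 < \<epsilon>"
  then obtain \<delta> where \<delta>: "0 < \<delta>" and small:
    "\<And>p q. 1 - \<delta> \<le> sphere_point p \<bullet> sphere_point q \<Longrightarrow> sphere_point p \<bullet> sphere_point q \<le> 1 \<Longrightarrow>
       dist (spherical_dist p q) 0 < \<epsilon>"
    by (rule small_spherical_dist) blast
  have "\<forall>\<^sub>F n in sequentially. \<forall>w\<in>S. sqrt (2 / \<delta>) \<le> norm (f n w)"
    using assms by (simp add: diverges_uniformly_def)
  then show "\<forall>\<^sub>F n in sequentially. \<forall>w\<in>S. dist (spherical_dist (Some (f n w)) None) 0 < \<epsilon>"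
  proof (rule eventually_mono, intro ballI)
    fix n w assume "\<forall>w\<in>S. sqrt (2 / \<delta>) \<le> norm (f n w)" and w: "w \<in> S"
    then have "(sqrt (2 / \<delta>))\<^sup>2 \<le> (norm (f n w))\<^sup>2"
      by (intro power_mono) (use \<delta> in auto)
    then have "2 / \<delta> \<le> 1 + (norm (f n w))\<^sup>2" using \<delta> by simp
    then have "2 / (1 + (norm (f n w))\<^sup>2) \<le> \<delta>"
      using \<delta> by (simp add: divide_le_eq add_pos_nonneg mult.commute)
    then show "dist (spherical_dist (Some (f n w)) None) 0 < \<epsilon>"
      by (intro small) (auto simp: inner_sphere_point_infinity)
  qed
qed

lemma sphere_val_holomorphic:
  assumes "f holomorphic_on S" "open S" "z \<in> S"
  shows "sphere_val f z = Some (f z)"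
  using not_is_pole_holomorphic[OF assms(2,3,1)] by (simp add: sphere_val_def)

text \<open>
  The two alternatives in \<open>Marty_subsequence\<close> are the two kinds of limit in the definition of
  normality; the limit of holomorphic functions has no poles unless it is identically infinite.
\<close>

lemma normal_family_if_spherical_deriv_bounded:
  assumes D: "open D" "connected D" and holF: "\<And>f. f \<in> F \<Longrightarrow> f holomorphic_on D"
    and bd: "\<And>z. z \<in> D \<Longrightarrow> \<exists>e>0. \<exists>B. \<forall>f\<in>F. \<forall>w\<in>ball z e. spherical_deriv f w \<le> B"
  shows "normal_family D F"
  unfolding normal_family_def
proof (intro allI impI)
  fix f :: "nat \<Rightarrow> complex \<Rightarrow> complex" assume f: "range f \<subseteq> F"
  have hol: "f n holomorphic_on D" for n using f holF by blast
  have "locally_bounded_spherical_deriv D f"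
    unfolding locally_bounded_spherical_deriv_def
  proof
    fix z assume z: "z \<in> D"
    obtain e B where e: "0 < e" "\<And>f w. f \<in> F \<Longrightarrow> w \<in> ball z e \<Longrightarrow> spherical_deriv f w \<le> B"
      using bd[OF z] by blast
    obtain e' where e': "0 < e'" "ball z e' \<subseteq> D" using D(1) z by (rule openE)
    have "f n holomorphic_on ball z (min e e')" for n
      using hol e'(2) by (rule holomorphic_on_subset[OF _ order_trans[rotated]]) auto
    moreover have "spherical_deriv (f n) w \<le> B" if "w \<in> ball z (min e e')" for n w
      using e(2)[of "f n" w] f that by auto
    moreover have "ball z (min e e') \<subseteq> D" using e'(2) by auto
    ultimately show "\<exists>e>0. \<exists>B. ball z e \<subseteq> D \<and> (\<forall>\<^sub>F n in sequentially. f n holomorphic_on ball z e \<and>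
        (\<forall>w\<in>ball z e. spherical_deriv (f n) w \<le> B))"
      using e(1) e'(1) by (intro exI[of _ "min e e'"] conjI exI[of _ B]) auto
  qed
  from Marty_subsequence[OF D this] obtain r where r: "strict_mono (r :: nat \<Rightarrow> nat)"
    and alt: "(\<exists>g. g holomorphic_on D \<and> locally_convergent_to D (\<lambda>n. f (r n)) g) \<or>
      locally_divergent D (\<lambda>n. f (r n))" by blast
  have val: "sphere_val (f n) w = Some (f n w)" if "w \<in> D" for n w
    by (rule sphere_val_holomorphic[OF hol D(1) that])
  have loc: "locally_uniform_limit_spherical D (\<lambda>n. sphere_val (f (r n))) G"
    if "\<And>z. z \<in> D \<Longrightarrow> \<exists>e>0. ball z e \<subseteq> D \<and>
        uniform_limit (ball z e) (\<lambda>n w. spherical_dist (Some (f (r n) w)) (G w)) (\<lambda>_. 0) sequentially" for G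
    unfolding locally_uniform_limit_spherical_def
  proof
    fix z assume "z \<in> D"
    from that[OF this] obtain e where e: "0 < e" "ball z e \<subseteq> D" and
      ul: "uniform_limit (ball z e) (\<lambda>n w. spherical_dist (Some (f (r n) w)) (G w)) (\<lambda>_. 0) sequentially"
      by blast
    have "uniform_limit (ball z e) (\<lambda>n w. spherical_dist (sphere_val (f (r n)) w) (G w)) (\<lambda>_. 0) sequentially"
    proof (rule uniform_limitI)
      fix \<epsilon> :: real assume "0 < \<epsilon>"
      from uniform_limitD[OF ul this]
      show "\<forall>\<^sub>F n in sequentially. \<forall>w\<in>ball z e. dist (spherical_dist (sphere_val (f (r n)) w) (G w)) 0 < \<epsilon>"
        by (rule eventually_mono) (use val e(2) in \<open>simp add: subset_iff\<close>)
    qed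
    then show "\<exists>e>0. ball z e \<subseteq> D \<and>
        uniform_limit (ball z e) (\<lambda>n w. spherical_dist (sphere_val (f (r n)) w) (G w)) (\<lambda>_. 0) sequentially"
      using e by blast
  qed
  show "\<exists>r g. strict_mono r \<and> locally_uniform_limit_spherical D (\<lambda>n. sphere_val (f (r n))) g \<and>
      ((\<exists>m. m nicely_meromorphic_on D \<and> (\<forall>z\<in>D. g z = sphere_val m z)) \<or> (\<forall>z\<in>D. g z = None))"
    using alt
  proof
    assume "\<exists>g. g holomorphic_on D \<and> locally_convergent_to D (\<lambda>n. f (r n)) g"
    then obtain g where g: "g holomorphic_on D" "locally_convergent_to D (\<lambda>n. f (r n)) g" by blast
    have "locally_uniform_limit_spherical D (\<lambda>n. sphere_val (f (r n))) (\<lambda>w. Some (g w))"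
      by (rule loc) (use g(2) uniform_limit_spherical in \<open>unfold locally_convergent_to_def, blast\<close>)
    moreover have "g nicely_meromorphic_on D"
      using g(1) D(1) by (intro analytic_on_imp_nicely_meromorphic_on) (simp add: analytic_on_open)
    moreover have "\<forall>z\<in>D. Some (g z) = sphere_val g z"
      using sphere_val_holomorphic[OF g(1) D(1)] by simp
    ultimately show ?thesis
      using r by (intro exI[of _ r] exI[of _ "\<lambda>w. Some (g w)"] conjI disjI1 exI[of _ g])
  next
    assume "locally_divergent D (\<lambda>n. f (r n))"
    then have "locally_uniform_limit_spherical D (\<lambda>n. sphere_val (f (r n))) (\<lambda>w. None)"
      by (intro loc) (use uniform_limit_spherical_infinity in \<open>unfold locally_divergent_def, blast\<close>)
    then show ?thesis
      using r by (intro exI[of _ r] exI[of _ "\<lambda>w. None"] conjI disjI2) auto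
  qed
qed


section \<open>Shared values\<close>

text \<open>
  An entire function of bounded spherical derivative without \<open>b\<close>-points is \<open>b + exp p\<close> with \<open>p\<close>
  linear: where \<open>Re p = 0\<close>, the modulus of \<open>exp p\<close> is 1, so that \<open>\<bar>deriv p\<bar> = \<bar>deriv g\<bar>\<close> is bounded and
  \<open>entire_deriv_constant\<close> applies. Such a function takes the value \<open>a\<close>, and its derivative has no zeros.
\<close>

lemma entire_simple_point:
  assumes g: "g holomorphic_on UNIV" and omit: "\<And>z. g z \<noteq> b" and ab: "a \<noteq> b"
    and sd: "\<And>z. spherical_deriv g z \<le> B" and nc: "deriv g z0 \<noteq> 0"
  shows "\<exists>z. g z = a \<and> deriv g z \<noteq> 0"
proof -
  have "(\<lambda>z. g z - b) holomorphic_on UNIV" by (intro holomorphic_intros g)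
  then obtain p where p: "p holomorphic_on UNIV" and gp: "\<And>z. g z - b = exp (p z)"
    using contractible_imp_holomorphic_log[of "\<lambda>z. g z - b" UNIV] omit by auto
  have gexp: "g = (\<lambda>z. exp (p z) + b)" using gp by (auto simp: diff_eq_eq)
  have dp: "(p has_field_derivative deriv p z) (at z)" for z
    by (rule holomorphic_derivI[OF p open_UNIV UNIV_I])
  have dg: "deriv g z = exp (p z) * deriv p z" for z
    unfolding gexp by (rule DERIV_imp_deriv) (auto intro!: derivative_eq_intros dp)
  have "norm (deriv p w) \<le> B * (1 + (1 + norm b)\<^sup>2)" if w: "Re (p w) = 0" for w
  proof -
    have B: "0 \<le> B" using sd[of w] spherical_deriv_nonneg order_trans by blast
    have e1: "norm (exp (p w)) = 1" by (simp add: norm_exp_eq_Re w)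
    then have "norm (g w) \<le> 1 + norm b"
      unfolding gexp using norm_triangle_ineq[of "exp (p w)" b] by simp
    then have "(norm (g w))\<^sup>2 \<le> (1 + norm b)\<^sup>2" by (rule power_mono) simp
    then have "spherical_deriv g w * (1 + (norm (g w))\<^sup>2) \<le> B * (1 + (1 + norm b)\<^sup>2)"
      using sd[of w] B by (intro mult_mono) auto
    moreover have "norm (deriv g w) = norm (deriv p w)" by (simp add: dg norm_mult w)
    ultimately show ?thesis by (simp add: norm_deriv_eq_spherical_deriv[symmetric])
  qed
  from entire_deriv_constant[OF p this] obtain A where A: "\<And>z. deriv p z = A" by blast
  have A0: "A \<noteq> 0" using nc by (auto simp: dg A)
  have "((\<lambda>z. p z - A * z) has_field_derivative 0) (at z)" for z
    using dp[of z] by (auto intro!: derivative_eq_intros simp: A)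
  then obtain c where c: "\<And>z. p z - A * z = c"
    using has_field_derivative_zero_constant[of UNIV "\<lambda>z. p z - A * z"] by auto
  define z where "z = (Ln (a - b) - c) / A"
  have "A * z = Ln (a - b) - c" using A0 by (simp add: z_def)
  then have "p z = Ln (a - b)" using c[of z] by simp
  then have ez: "exp (p z) = a - b" using ab by simp
  then have "g z = a" by (simp add: gexp)
  moreover have "deriv g z \<noteq> 0" using ab A0 by (simp add: dg A ez)
  ultimately show ?thesis by blast
qed

lemma partially_share_holomorphic:
  assumes share: "partially_share D f (deriv f) \<alpha> \<beta>" and f: "f holomorphic_on D" and D: "open D"
    and z: "z \<in> D" "f z = \<alpha>"
  shows "deriv f z = \<beta> z"
  using share z sphere_val_holomorphic[OF f D z(1)]
    sphere_val_holomorphic[OF holomorphic_deriv[OF f D] D z(1)]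
  by (auto simp: partially_share_def)

text \<open>
  Assuming the contrary, the limit \<open>g\<close> of Zalcman's rescaling omits \<open>b\<close>, and all its \<open>a\<close>-points are
  multiple, contrary to \<open>entire_simple_point\<close>. The constant \<open>c\<close> may vary with \<open>f\<close>: after rescaling it is
  multiplied by \<open>\<rho>\<close>, so a common bound makes it tend to 0, while for each single function it stays
  different from 0. The
  compact set supplied by the rescaling bounds \<open>h\<close>.
\<close>

lemma spherical_deriv_bounded_if_shared:
  assumes D: "open D" and holF: "\<And>f. f \<in> F \<Longrightarrow> f holomorphic_on D" and ab: "a \<noteq> b"
    and h: "continuous_on D h"
    and share_a: "\<And>f z. f \<in> F \<Longrightarrow> z \<in> D \<Longrightarrow> f z = a \<Longrightarrow> deriv f z = h z"
    and share_b: "\<And>f. f \<in> F \<Longrightarrow> \<exists>c. c \<noteq> 0 \<and> norm c \<le> C \<and> (\<forall>z\<in>D. f z = b \<longrightarrow> deriv f z = c)"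
    and z0: "z0 \<in> D"
  shows "\<exists>e>0. \<exists>B. \<forall>f\<in>F. \<forall>w\<in>ball z0 e. spherical_deriv f w \<le> B"
proof (rule ccontr)
  assume unb: "\<not> ?thesis"
  have large: "\<exists>f\<in>F. \<exists>w\<in>ball z0 e. B < spherical_deriv f w" if "0 < e" for e B
    using unb that by (meson not_le)
  obtain K f \<rho> w g
    where K: "compact K" "K \<subseteq> D" and f': "\<forall>n::nat. f n \<in> F" and \<rho>': "\<forall>n. 0 < (\<rho> n :: real)" and \<rho>lim: "\<rho> \<longlonglongrightarrow> 0"
      and inK': "\<forall>R. \<forall>\<^sub>F n in sequentially. \<forall>\<zeta>\<in>ball 0 R. w n + of_real (\<rho> n) * \<zeta> \<in> K"
      and g: "g holomorphic_on UNIV"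
      and lim: "locally_convergent_to UNIV (\<lambda>n \<zeta>. f n (w n + of_real (\<rho> n) * \<zeta>)) g"
      and sd0: "spherical_deriv g 0 = 1" and sd': "\<forall>\<zeta>. spherical_deriv g \<zeta> \<le> 2"
    by (rule Zalcman[OF D z0 holF large])
  note f = f'[rule_format] and \<rho> = \<rho>'[rule_format] and inK = inK'[rule_format] and sd = sd'[rule_format]
  define \<phi> where "\<phi> n \<zeta> = f n (w n + of_real (\<rho> n) * \<zeta>)" for n \<zeta>
  have dg0: "deriv g 0 \<noteq> 0" using sd0 by (auto simp: spherical_deriv_def)
  have nc: "\<not> g constant_on ball z e" if e: "0 < e" for z e
  proof
    assume "g constant_on ball z e"
    then obtain k where k: "\<And>x. x \<in> ball z e \<Longrightarrow> g x = k" by (auto simp: constant_on_def)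
    have "g x = k" for x
    proof (rule analytic_continuation_open[of "ball z e" UNIV g "\<lambda>_. k" x])
      show "ball z e \<noteq> {}" using e by simp
    qed (use g k in auto)
    then have "g = (\<lambda>_. k)" by auto
    then show False using dg0 by simp
  qed
  have "\<exists>c. \<forall>n. c n \<noteq> 0 \<and> norm (c n) \<le> C \<and> (\<forall>z\<in>D. f n z = b \<longrightarrow> deriv (f n) z = c n)"
    by (rule choice) (use share_b f in blast)
  then obtain c where c: "\<And>n. c n \<noteq> 0" "\<And>n. norm (c n) \<le> C"
    "\<And>n z. z \<in> D \<Longrightarrow> f n z = b \<Longrightarrow> deriv (f n) z = c n" by blast
  have "bounded (h ` K)"
    by (intro compact_imp_bounded compact_continuous_image K continuous_on_subset[OF h])
  then have "\<exists>H. \<forall>z\<in>K. norm (h z) \<le> H" by (simp add: bounded_iff)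
  then obtain H where H: "\<And>z. z \<in> K \<Longrightarrow> norm (h z) \<le> H" by blast
  \<comment> \<open>the rescaled functions are defined near any given point only from some index on\<close>
  have near: "\<exists>e>0. uniform_limit (ball z e) \<phi> g sequentially \<and>
      (\<forall>\<^sub>F n in sequentially. \<forall>\<zeta>\<in>ball z e. w n + of_real (\<rho> n) * \<zeta> \<in> K) \<and>
      (\<forall>\<^sub>F n in sequentially. \<phi> n holomorphic_on ball z e)" for z
  proof -
    obtain e where e: "0 < e" "uniform_limit (ball z e) \<phi> g sequentially"
      using lim unfolding locally_convergent_to_def \<phi>_def[abs_def] by blast
    have sub: "ball z e \<subseteq> ball 0 (norm z + e)"
    proof
      fix x assume "x \<in> ball z e"
      then show "x \<in> ball 0 (norm z + e)"
        using norm_triangle_ineq2[of x z] by (simp add: dist_norm norm_minus_commute)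
    qed
    have ev: "\<forall>\<^sub>F n in sequentially. \<forall>\<zeta>\<in>ball z e. w n + of_real (\<rho> n) * \<zeta> \<in> K"
      using inK[of "norm z + e"] by (rule eventually_mono) (use sub in blast)
    then have "\<forall>\<^sub>F n in sequentially. \<phi> n holomorphic_on ball z e"
    proof eventually_elim
      case (elim n)
      have "f n \<circ> (\<lambda>\<zeta>. w n + of_real (\<rho> n) * \<zeta>) holomorphic_on ball z e"
        using elim K(2)
        by (intro holomorphic_on_compose_gen[OF _ holF[OF f]] holomorphic_intros) auto
      then show ?case by (simp add: o_def \<phi>_def[abs_def])
    qed
    with e ev show ?thesis by blast
  qed
  have d\<phi>: "deriv (\<phi> n) \<zeta> = of_real (\<rho> n) * deriv (f n) (w n + of_real (\<rho> n) * \<zeta>)"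
    if "w n + of_real (\<rho> n) * \<zeta> \<in> K" for n \<zeta>
    unfolding \<phi>_def[abs_def]
    by (rule spherical_deriv_rescale(1)[OF holomorphic_on_imp_differentiable_at[OF holF[OF f] D] \<rho>])
       (use that K(2) in blast)
  have omit: "g z \<noteq> b" for z
  proof -
    obtain e where e: "0 < e" and ul: "uniform_limit (ball z e) \<phi> g sequentially"
      and ev: "\<forall>\<^sub>F n in sequentially. \<forall>\<zeta>\<in>ball z e. w n + of_real (\<rho> n) * \<zeta> \<in> K"
      and hol: "\<forall>\<^sub>F n in sequentially. \<phi> n holomorphic_on ball z e"
      using near by blast
    show ?thesis
    proof (rule limit_omits_value[OF ul e hol _ _ _ _ nc[OF e]])
      show "g holomorphic_on ball z e" using g by (rule holomorphic_on_subset) simp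
      show "\<forall>\<^sub>F n in sequentially. \<forall>\<zeta>\<in>ball z e. \<phi> n \<zeta> = b \<longrightarrow> deriv (\<phi> n) \<zeta> = of_real (\<rho> n) * c n"
        using ev by (rule eventually_mono) (use c(3) d\<phi> K(2) in \<open>auto simp: \<phi>_def\<close>)
      show "of_real (\<rho> n) * c n \<noteq> 0" for n using \<rho>[of n] c(1)[of n] by simp
      have "(\<lambda>n. \<rho> n * C) \<longlonglongrightarrow> 0" using tendsto_mult_left_zero[OF \<rho>lim] .
      then show "(\<lambda>n. of_real (\<rho> n) * c n) \<longlonglongrightarrow> 0"
        by (rule Lim_null_comparison[rotated])
           (auto simp: norm_mult abs_of_pos[OF \<rho>] intro!: always_eventually mult_left_mono c(2) less_imp_le[OF \<rho>])
    qed
  qed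
  have ram: "deriv g z = 0" if gz: "g z = a" for z
  proof -
    obtain e where e: "0 < e" and ul: "uniform_limit (ball z e) \<phi> g sequentially"
      and ev: "\<forall>\<^sub>F n in sequentially. \<forall>\<zeta>\<in>ball z e. w n + of_real (\<rho> n) * \<zeta> \<in> K"
      and hol: "\<forall>\<^sub>F n in sequentially. \<phi> n holomorphic_on ball z e"
      using near by blast
    show ?thesis
    proof (rule limit_ramified_value[OF ul e hol _ _ _ nc gz])
      show "g holomorphic_on ball z e" using g by (rule holomorphic_on_subset) simp
      show "\<forall>\<^sub>F n in sequentially. \<forall>\<zeta>\<in>ball z e. \<phi> n \<zeta> = a \<longrightarrow> norm (deriv (\<phi> n) \<zeta>) \<le> \<rho> n * H"
        using ev
      proof (rule eventually_mono, intro ballI impI)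
        fix n \<zeta> assume *: "\<forall>\<zeta>\<in>ball z e. w n + of_real (\<rho> n) * \<zeta> \<in> K" "\<zeta> \<in> ball z e" "\<phi> n \<zeta> = a"
        let ?x = "w n + of_real (\<rho> n) * \<zeta>"
        have x: "?x \<in> K" using * by blast
        then have "?x \<in> D" using K(2) by blast
        then have "deriv (f n) ?x = h ?x" using share_a[OF f] *(3) by (simp add: \<phi>_def)
        then show "norm (deriv (\<phi> n) \<zeta>) \<le> \<rho> n * H"
          using \<rho>[of n] H[OF x] by (simp add: d\<phi>[OF x] norm_mult)
      qed
      show "(\<lambda>n. \<rho> n * H) \<longlonglongrightarrow> 0" using tendsto_mult_left_zero[OF \<rho>lim] .
    qed
  qed
  from entire_simple_point[OF g omit ab sd dg0] ram show False by blast
qed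

theorem theorem2p6:
  fixes D :: "complex set" and F :: "(complex \<Rightarrow> complex) set"
    and a b :: complex and h :: "complex \<Rightarrow> complex" and \<rho> :: real
  assumes "open D" and "connected D" and "D \<noteq> {}"
    and "\<And>f. f \<in> F \<Longrightarrow> f holomorphic_on D"
    and "a \<noteq> b"
    and "h holomorphic_on D"
    and "\<rho> > 0"
    and "\<And>f. f \<in> F \<Longrightarrow> \<exists>c \<in> punctured_disk \<rho>.
           partially_share D f (deriv f) a h \<and> partially_share D f (deriv f) b (\<lambda>_. c)"
  shows "normal_family D F"
proof (rule normal_family_if_spherical_deriv_bounded[OF assms(1,2,4)])
  fix z assume "z \<in> D"
  show "\<exists>e>0. \<exists>B. \<forall>f\<in>F. \<forall>w\<in>ball z e. spherical_deriv f w \<le> B"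
  proof (rule spherical_deriv_bounded_if_shared[OF assms(1,4,5) _ _ _ \<open>z \<in> D\<close>])
    show "continuous_on D h" by (rule holomorphic_on_imp_continuous_on[OF assms(6)])
    show "deriv f w = h w" if "f \<in> F" "w \<in> D" "f w = a" for f w
      using assms(8)[OF that(1)] partially_share_holomorphic[OF _ assms(4)[OF that(1)] assms(1) that(2,3)]
      by blast
    show "\<exists>c. c \<noteq> 0 \<and> norm c \<le> \<rho> \<and> (\<forall>w\<in>D. f w = b \<longrightarrow> deriv f w = c)" if fF: "f \<in> F" for f
    proof -
      obtain c where c: "c \<in> punctured_disk \<rho>" "partially_share D f (deriv f) b (\<lambda>_. c)"
        using assms(8)[OF fF] by blast
      have "deriv f w = c" if "w \<in> D" "f w = b" for w
        using partially_share_holomorphic[OF c(2) assms(4)[OF fF] assms(1) that] .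
      then show ?thesis using c(1) by (intro exI[of _ c]) (auto simp: punctured_disk_def)
    qed
  qed
qed

end
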